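(* There exist Short $\mathbb{C}^2$'s that are not biholomorphically equivalent to a Reinhardt domain; that is, there exists a Short $\mathbb{C}^2$ that is not biholomorphic to any Reinhardt domain in $\mathbb{C}^2$.
   Context: A Short $\mathbb{C}^2$ is a domain $\Omega\subset\mathbb{C}^2$ with the following properties: it can be exhausted by an increasing sequence of biholomorphic images of the unit ball $\mathbb{B}^2\subset\mathbb{C}^2$ (i.e. it is the union of this increasing sequence); the Kobayashi metric on $\Omega$ vanishes identically; and $\Omega$ admits a non-constant plurisubharmonic function that is bounded above. A domain $G\subset\mathbb{C}^2$ is Reinhardt if $(e^{i\theta_1}x,e^{i\theta_2}y)\in G$ for all $(x,y)\in G$ and all $\theta_1,\theta_2\in\mathbb{R}$. *)

theory Defs
  imports "HOL-Complex_Analysis.Complex_Analysis"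
begin

text \<open>
  \<open>\<complex>\<^sup>2\<close> is the product type \<open>complex \<times> complex\<close>, whose library norm is the Euclidean
  one, so that \<open>ball 0 1\<close> is the standard unit ball.
\<close>

type_synonym complex2 = "complex \<times> complex"

text \<open>The library provides only the real scalar multiplication on this type.\<close>

definition cscale :: "complex \<Rightarrow> complex2 \<Rightarrow> complex2" where
  "cscale c v = (c * fst v, c * snd v)"

definition domain2 :: "complex2 set \<Rightarrow> bool" where
  "domain2 \<Omega> \<longleftrightarrow> open \<Omega> \<and> connected \<Omega> \<and> \<Omega> \<noteq> {}"

text \<open>
  Meant for open sets only: the derivative is taken with respect to full neighbourhoods.
\<close>

definition holomorphic2_on :: "(complex2 \<Rightarrow> complex2) \<Rightarrow> complex2 set \<Rightarrow> bool" where
  "holomorphic2_on f U \<longleftrightarrow>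
     (\<forall>p\<in>U. \<exists>D. (f has_derivative D) (at p) \<and> (\<forall>c v. D (cscale c v) = cscale c (D v)))"

definition biholomorphic_map :: "(complex2 \<Rightarrow> complex2) \<Rightarrow> complex2 set \<Rightarrow> complex2 set \<Rightarrow> bool" where
  "biholomorphic_map f U V \<longleftrightarrow>
     holomorphic2_on f U \<and> bij_betw f U V \<and> holomorphic2_on (inv_into U f) V"

definition biholomorphic2 :: "complex2 set \<Rightarrow> complex2 set \<Rightarrow> bool" where
  "biholomorphic2 U V \<longleftrightarrow> (\<exists>f. biholomorphic_map f U V)"

definition reinhardt :: "complex2 set \<Rightarrow> bool" where
  "reinhardt G \<longleftrightarrow>
     (\<forall>x y. (x, y) \<in> G \<longrightarrow>
        (\<forall>\<theta>\<^sub>1 \<theta>\<^sub>2 :: real. (exp (\<i> * of_real \<theta>\<^sub>1) * x, exp (\<i> * of_real \<theta>\<^sub>2) * y) \<in> G))"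

text \<open>
  The infinitesimal Kobayashi(--Royden) metric at a point \<open>p\<close> of \<open>\<Omega>\<close> in direction \<open>v\<close>.
\<close>

definition kobayashi_metric :: "complex2 set \<Rightarrow> complex2 \<Rightarrow> complex2 \<Rightarrow> ereal" where
  "kobayashi_metric \<Omega> p v = Inf {ereal \<alpha> | \<alpha>. \<alpha> > 0 \<and>
     (\<exists>\<phi> :: complex \<Rightarrow> complex2.
        (\<lambda>z. fst (\<phi> z)) holomorphic_on ball 0 1 \<and> (\<lambda>z. snd (\<phi> z)) holomorphic_on ball 0 1 \<and>
        \<phi> ` ball 0 1 \<subseteq> \<Omega> \<and> \<phi> 0 = p \<and>
        cscale (of_real \<alpha>) (deriv (\<lambda>z. fst (\<phi> z)) 0, deriv (\<lambda>z. snd (\<phi> z)) 0) = v)}"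

text \<open>
  The mean over \<open>[0, 2\<pi>]\<close> of an extended real function, as the mean of the positive part minus
  that of the negative part (\<open>e2ennreal\<close> sends negative numbers to \<open>0\<close>).  For an upper
  semicontinuous function with values in \<open>[-\<infinity>, \<infinity>)\<close> on a circle the first integral is finite, so
  the difference is well defined, with value in \<open>[-\<infinity>, \<infinity>)\<close>.
\<close>

definition circle_mean :: "(real \<Rightarrow> ereal) \<Rightarrow> ereal" where
  "circle_mean h =
     (enn2ereal (\<integral>\<^sup>+\<theta>\<in>{0..2*pi}. e2ennreal (h \<theta>) \<partial>lborel) -
      enn2ereal (\<integral>\<^sup>+\<theta>\<in>{0..2*pi}. e2ennreal (- h \<theta>) \<partial>lborel)) / ereal (2 * pi)"

text \<open>
  Values in \<open>[-\<infinity>, \<infinity>)\<close>, upper semicontinuity, and the sub-mean value inequality on every closed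
  disc contained in \<open>\<Omega>\<close> and in a complex line.  The function that is identically \<open>-\<infinity>\<close> is allowed.
\<close>

definition plurisubharmonic_on :: "(complex2 \<Rightarrow> ereal) \<Rightarrow> complex2 set \<Rightarrow> bool" where
  "plurisubharmonic_on u \<Omega> \<longleftrightarrow>
     (\<forall>p\<in>\<Omega>. u p < \<infinity>) \<and>
     (\<forall>p\<in>\<Omega>. \<forall>c. u p < c \<longrightarrow> (\<forall>\<^sub>F q in at p within \<Omega>. u q < c)) \<and>
     (\<forall>p v. (\<forall>\<zeta>\<in>cball 0 1. p + cscale \<zeta> v \<in> \<Omega>) \<longrightarrow>
        u p \<le> circle_mean (\<lambda>\<theta>. u (p + cscale (exp (\<i> * of_real \<theta>)) v)))"

definition short_C2 :: "complex2 set \<Rightarrow> bool" where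
  "short_C2 \<Omega> \<longleftrightarrow>
     domain2 \<Omega> \<and>
     (\<exists>B :: nat \<Rightarrow> complex2 set.
        incseq B \<and> (\<forall>n. biholomorphic2 (ball 0 1) (B n)) \<and> \<Omega> = (\<Union>n. B n)) \<and>
     (\<forall>p\<in>\<Omega>. \<forall>v. kobayashi_metric \<Omega> p v = 0) \<and>
     (\<exists>u. plurisubharmonic_on u \<Omega> \<and> \<not> (\<exists>c. \<forall>p\<in>\<Omega>. u p = c) \<and> (\<exists>M :: real. \<forall>p\<in>\<Omega>. u p \<le> ereal M))"

end

theory Submission
  imports Defs
begin

text \<open>
  The Short \<open>\<complex>\<^sup>2\<close> is Fornaess' basin of a non-autonomous sequence of Henon maps
  \<open>(z, w) \<mapsto> (z\<^sup>2 + a\<^sub>n w, a\<^sub>n z)\<close> whose coefficients decrease so fast that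
  \<open>2\<^sup>-\<^sup>n ln \<bar>z\<^sub>n\<bar>\<close>, cut off at \<open>ln (1/16)\<close>, converges to a continuous plurisubharmonic function.
  The basin is the increasing union of the preimages of one small ball, and its Kobayashi metric
  vanishes because derivatives along orbits tend to \<open>0\<close>.

  In fact no Reinhardt domain can be a Short \<open>\<complex>\<^sup>2\<close>. A Reinhardt domain that is an increasing
  union of balls contains points of both axes (it is simply connected), hence by the
  Kontinuitaetssatz it is complete and logarithmically convex. If it is not \<open>\<complex>\<^sup>2\<close>, its logarithmic
  image lies in a half plane, so \<open>\<bar>x\<bar>\<^sup>a \<bar>y\<bar>\<^sup>b\<close> is bounded with \<open>a, b \<ge> 0\<close> not both zero, and a
  Schwarz-type estimate for this possibly multivalued monomial shows that the Kobayashi metric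
  does not vanish. Finally the basin is not \<open>\<complex>\<^sup>2\<close>, because the bounded plurisubharmonic function is
  constant along entire curves.
\<close>

section \<open>Biholomorphic maps and the Kobayashi metric\<close>

text \<open>The Reinhardt half rests on the exhaustion by balls and the vanishing Kobayashi metric.
  C^2 itself is Reinhardt and has both, so that half can conclude no more than G = C^2, and the
  bounded potential has to decide the last case. The exponents a and b may be irrational and the
  coordinates of a disc may vanish, so no holomorphic function with modulus |x|^a |y|^b is at hand:
  zeros are first pushed out of a disc whose radius depends on the centre and the bound alone, and a
  branch of the monomial is differentiated there. On the basin side, the cut-off after n steps is
  (1/16)^(2^n). It squares along with the leading term of the map, and each coefficient is half the
  next cut-off, so one step disturbs the logarithm by at most ln 2. From stage 0 on, all
  disturbances together change the potential by at most ln 2, less than the gap between ln (1/4) and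
  ln (1/16); this is why the limit is not constant. The cut-off also keeps every function finite, so
  continuity and integration stay elementary.\<close>

declare split_paired_All [simp del] split_paired_Ex [simp del]

lemma fst_cscale [simp]: "fst (cscale c v) = c * fst v"
  and snd_cscale [simp]: "snd (cscale c v) = c * snd v"
  by (simp_all add: cscale_def)

lemma holomorphic2_onE:
  assumes "holomorphic2_on f U" "p \<in> U"
  obtains D where "(f has_derivative D) (at p)" "\<forall>c v. D (cscale c v) = cscale c (D v)"
  using assms unfolding holomorphic2_on_def by blast

lemma holomorphic2_on_subset: "holomorphic2_on f U \<Longrightarrow> V \<subseteq> U \<Longrightarrow> holomorphic2_on f V"
  by (auto simp: holomorphic2_on_def)

lemma holomorphic2_on_imp_continuous_on: "holomorphic2_on f U \<Longrightarrow> continuous_on U f"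
  unfolding holomorphic2_on_def
  by (metis continuous_at_imp_continuous_on has_derivative_continuous)

lemma holomorphic2_on_compose:
  assumes "holomorphic2_on f U" "holomorphic2_on g V" "f ` U \<subseteq> V"
  shows "holomorphic2_on (g \<circ> f) U"
  unfolding holomorphic2_on_def
proof
  fix p assume p: "p \<in> U"
  obtain D where D: "(f has_derivative D) (at p)" "\<forall>c v. D (cscale c v) = cscale c (D v)"
    by (rule holomorphic2_onE[OF assms(1) p])
  obtain E where E: "(g has_derivative E) (at (f p))" "\<forall>c v. E (cscale c v) = cscale c (E v)"
    by (rule holomorphic2_onE[OF assms(2)]) (use assms(3) p in auto)
  have "((g \<circ> f) has_derivative (E \<circ> D)) (at p)"
    using D(1) E(1) by (rule diff_chain_at)
  then show "\<exists>D. ((g \<circ> f) has_derivative D) (at p) \<and> (\<forall>c v. D (cscale c v) = cscale c (D v))"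
    using D(2) E(2) by (intro exI[of _ "E \<circ> D"]) auto
qed

lemma holomorphic2_on_cong_open:
  assumes "open U" "\<And>p. p \<in> U \<Longrightarrow> f p = g p" "holomorphic2_on g U"
  shows "holomorphic2_on f U"
  unfolding holomorphic2_on_def
proof
  fix p assume p: "p \<in> U"
  obtain D where D: "(g has_derivative D) (at p)" "\<forall>c v. D (cscale c v) = cscale c (D v)"
    by (rule holomorphic2_onE[OF assms(3) p])
  have "(f has_derivative D) (at p)"
    by (rule has_derivative_transform_within_open[OF D(1) assms(1) p]) (use assms(2) in auto)
  then show "\<exists>D. (f has_derivative D) (at p) \<and> (\<forall>c v. D (cscale c v) = cscale c (D v))"
    using D(2) by blast
qed

text \<open>The definition speaks of \<open>inv_into U f\<close>, whose values outside the image of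
  \<open>U\<close> are arbitrary. An explicit inverse agrees with it on \<open>V\<close>, and as
  \<open>V\<close> is open that determines the derivatives there.\<close>

lemma biholomorphic_mapI:
  assumes "open U" "open V" "holomorphic2_on f U" "holomorphic2_on g V"
    and "\<And>p. p \<in> U \<Longrightarrow> f p \<in> V" "\<And>p. p \<in> V \<Longrightarrow> g p \<in> U"
    and "\<And>p. p \<in> U \<Longrightarrow> g (f p) = p" "\<And>p. p \<in> V \<Longrightarrow> f (g p) = p"
  shows "biholomorphic_map f U V"
proof -
  have bij: "bij_betw f U V"
    by (rule bij_betw_byWitness[where f' = g]) (use assms in auto)
  have "inv_into U f p = g p" if "p \<in> V" for p
    using inv_into_f_f[of f U "g p"] bij_betw_imp_inj_on[OF bij] assms(6,8)[OF that] by simp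
  then have "holomorphic2_on (inv_into U f) V"
    by (rule holomorphic2_on_cong_open[OF assms(2) _ assms(4)])
  then show ?thesis
    using assms bij by (simp add: biholomorphic_map_def)
qed

lemma biholomorphic2E:
  assumes "biholomorphic2 U V"
  obtains f g where "holomorphic2_on f U" "holomorphic2_on g V"
    "\<forall>p\<in>U. f p \<in> V" "\<forall>p\<in>V. g p \<in> U"
    "\<forall>p\<in>U. g (f p) = p" "\<forall>p\<in>V. f (g p) = p"
proof -
  obtain f where f: "biholomorphic_map f U V"
    using assms by (auto simp: biholomorphic2_def)
  then have b: "bij_betw f U V" by (simp add: biholomorphic_map_def)
  let ?g = "inv_into U f"
  have "\<forall>p\<in>U. f p \<in> V" "\<forall>p\<in>V. ?g p \<in> U"
    using bij_betwE[OF b] bij_betwE[OF bij_betw_inv_into[OF b]] by blast+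
  moreover have "\<forall>p\<in>U. ?g (f p) = p" "\<forall>p\<in>V. f (?g p) = p"
    using b by (simp_all add: bij_betw_inv_into_left bij_betw_inv_into_right)
  ultimately show ?thesis
    using f that unfolding biholomorphic_map_def by blast
qed

lemma biholomorphic2_open:
  assumes "biholomorphic2 U V" "open U"
  shows "open V"
proof -
  obtain f where f: "biholomorphic_map f U V"
    using assms by (auto simp: biholomorphic2_def)
  then have "continuous_on U f" "bij_betw f U V"
    by (auto simp: biholomorphic_map_def holomorphic2_on_imp_continuous_on)
  then show ?thesis
    using invariance_of_domain[of U f] assms(2) by (auto simp: bij_betw_def)
qed

lemma biholomorphic2_trans:
  assumes "biholomorphic2 U V" "biholomorphic2 V W" "open U"
  shows "biholomorphic2 U W"
proof -
  obtain f g where fg: "holomorphic2_on f U" "holomorphic2_on g V"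
    "\<forall>p\<in>U. f p \<in> V" "\<forall>p\<in>V. g p \<in> U"
    "\<forall>p\<in>U. g (f p) = p" "\<forall>p\<in>V. f (g p) = p"
    by (rule biholomorphic2E[OF assms(1)])
  obtain h k where hk: "holomorphic2_on h V" "holomorphic2_on k W"
    "\<forall>p\<in>V. h p \<in> W" "\<forall>p\<in>W. k p \<in> V"
    "\<forall>p\<in>V. k (h p) = p" "\<forall>p\<in>W. h (k p) = p"
    by (rule biholomorphic2E[OF assms(2)])
  have "open W" using assms biholomorphic2_open by blast
  moreover have "holomorphic2_on (h \<circ> f) U" "holomorphic2_on (g \<circ> k) W"
    by (rule holomorphic2_on_compose[OF fg(1) hk(1)], use fg(3) in blast)
      (rule holomorphic2_on_compose[OF hk(2) fg(2)], use hk(4) in blast)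
  ultimately have "biholomorphic_map (h \<circ> f) U W"
    by (intro biholomorphic_mapI[where g = "g \<circ> k"]) (simp_all add: assms(3) fg hk)
  then show ?thesis by (auto simp: biholomorphic2_def)
qed

lemma biholomorphic2_restrict:
  assumes "holomorphic2_on f U" "holomorphic2_on g V"
    "\<And>p. p \<in> U \<Longrightarrow> f p \<in> V" "\<And>p. p \<in> U \<Longrightarrow> g (f p) = p" "open B" "B \<subseteq> U"
  shows "biholomorphic2 B (f ` B)"
proof -
  have "inj_on f B"
    by (rule inj_on_inverseI[where g = g]) (use assms in blast)
  then have "open (f ` B)"
    using invariance_of_domain[OF _ assms(5)] holomorphic2_on_imp_continuous_on
      holomorphic2_on_subset[OF assms(1,6)] by blast
  moreover have "holomorphic2_on f B" "holomorphic2_on g (f ` B)"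
    using assms by (blast intro: holomorphic2_on_subset)+
  ultimately have "biholomorphic_map f B (f ` B)"
    using assms by (intro biholomorphic_mapI[where g = g]) (auto simp: subset_iff)
  then show ?thesis by (auto simp: biholomorphic2_def)
qed

text \<open>Chain rule for a holomorphic curve followed by a holomorphic map. \<open>D\<close> may
  be any derivative of \<open>h\<close>: uniqueness identifies it with the complex linear one, which
  makes the composite complex differentiable.\<close>

lemma holomorphic2_on_curve:
  assumes "holomorphic2_on h U" "open S" "(\<lambda>z. fst (\<phi> z)) holomorphic_on S"
    "(\<lambda>z. snd (\<phi> z)) holomorphic_on S" "\<phi> ` S \<subseteq> U"
  shows "(\<lambda>z. fst (h (\<phi> z))) holomorphic_on S" "(\<lambda>z. snd (h (\<phi> z))) holomorphic_on S"
    and "z \<in> S \<Longrightarrow> (h has_derivative D) (at (\<phi> z)) \<Longrightarrow>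
      (deriv (\<lambda>z. fst (h (\<phi> z))) z, deriv (\<lambda>z. snd (h (\<phi> z))) z)
        = D (deriv (\<lambda>z. fst (\<phi> z)) z, deriv (\<lambda>z. snd (\<phi> z)) z)"
proof -
  have *: "((\<lambda>z. fst (h (\<phi> z))) has_field_derivative
        fst (D (deriv (\<lambda>z. fst (\<phi> z)) z, deriv (\<lambda>z. snd (\<phi> z)) z))) (at z) \<and>
      ((\<lambda>z. snd (h (\<phi> z))) has_field_derivative
        snd (D (deriv (\<lambda>z. fst (\<phi> z)) z, deriv (\<lambda>z. snd (\<phi> z)) z))) (at z)"
    if z: "z \<in> S" and D: "(h has_derivative D) (at (\<phi> z))" for z D
  proof -
    let ?w = "(deriv (\<lambda>z. fst (\<phi> z)) z, deriv (\<lambda>z. snd (\<phi> z)) z)"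
    obtain E where E: "(h has_derivative E) (at (\<phi> z))" "\<forall>c v. E (cscale c v) = cscale c (E v)"
      by (rule holomorphic2_onE[OF assms(1)]) (use assms(5) z in blast)
    have "E = D" using E(1) D by (rule has_derivative_unique)
    then have lin: "D (cscale c v) = cscale c (D v)" for c v using E by auto
    have "((\<lambda>z. fst (\<phi> z)) has_derivative (\<lambda>c. c * fst ?w)) (at z)"
         "((\<lambda>z. snd (\<phi> z)) has_derivative (\<lambda>c. c * snd ?w)) (at z)"
      using holomorphic_derivI[OF assms(3,2) z] holomorphic_derivI[OF assms(4,2) z]
      by (simp_all add: has_field_derivative_def mult_commute_abs)
    then have "((\<lambda>z. (fst (\<phi> z), snd (\<phi> z))) has_derivative (\<lambda>c. cscale c ?w)) (at z)"
      unfolding cscale_def by (rule has_derivative_Pair)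
    then have "(\<phi> has_derivative (\<lambda>c. cscale c ?w)) (at z)" by simp
    from diff_chain_at[OF this D]
    have "((\<lambda>z. h (\<phi> z)) has_derivative (\<lambda>c. cscale c (D ?w))) (at z)"
      by (simp add: o_def lin)
    from has_derivative_fst[OF this] has_derivative_snd[OF this]
    show ?thesis
      by (simp add: has_field_derivative_def mult_commute_abs)
  qed
  have ex: "\<exists>D. (h has_derivative D) (at (\<phi> z))" if "z \<in> S" for z
    using assms(1,5) that unfolding holomorphic2_on_def by blast
  show "(\<lambda>z. fst (h (\<phi> z))) holomorphic_on S" "(\<lambda>z. snd (h (\<phi> z))) holomorphic_on S"
    unfolding holomorphic_on_open[OF assms(2)] using * ex by blast+
  show "(deriv (\<lambda>z. fst (h (\<phi> z))) z, deriv (\<lambda>z. snd (h (\<phi> z))) z)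
        = D (deriv (\<lambda>z. fst (\<phi> z)) z, deriv (\<lambda>z. snd (\<phi> z)) z)"
    if "z \<in> S" "(h has_derivative D) (at (\<phi> z))"
    using *[OF that] by (intro prod_eqI) (auto dest!: DERIV_imp_deriv)
qed

text \<open>The infimum runs over positive numbers (and is infinite over the empty set), so it
  vanishes exactly when there are discs whose derivative at 0 is an arbitrarily large positive
  multiple of \<open>v\<close>.\<close>

lemma kobayashi_metric_eq_0_iff:
  "kobayashi_metric \<Omega> p v = 0 \<longleftrightarrow> (\<forall>\<epsilon>>0. \<exists>\<alpha> \<phi>. 0 < \<alpha> \<and> \<alpha> < \<epsilon> \<and>
        (\<lambda>z. fst (\<phi> z)) holomorphic_on ball 0 1 \<and> (\<lambda>z. snd (\<phi> z)) holomorphic_on ball 0 1 \<and>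
        \<phi> ` ball 0 1 \<subseteq> \<Omega> \<and> \<phi> 0 = p \<and>
        cscale (of_real \<alpha>) (deriv (\<lambda>z. fst (\<phi> z)) 0, deriv (\<lambda>z. snd (\<phi> z)) 0) = v)"
  (is "_ \<longleftrightarrow> (\<forall>\<epsilon>>0. \<exists>\<alpha> \<phi>. 0 < \<alpha> \<and> \<alpha> < \<epsilon> \<and> ?P \<alpha> \<phi>)")
proof -
  let ?A = "{ereal \<alpha> | \<alpha>. \<alpha> > 0 \<and> (\<exists>\<phi>. ?P \<alpha> \<phi>)}"
  have ge: "0 \<le> Inf ?A" by (intro Inf_greatest) auto
  have "x = 0 \<longleftrightarrow> (\<forall>\<epsilon>>0. x < ereal \<epsilon>)" if "0 \<le> x" for x
  proof (cases x)
    case (real r)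
    then have "r = 0" if "\<forall>\<epsilon>>0. x < ereal \<epsilon>"
      using that[rule_format, of r] \<open>0 \<le> x\<close> by (cases "r > 0") auto
    with real show ?thesis by auto
  next
    case PInf
    then show ?thesis by (auto intro!: exI[of _ 1])
  qed (use that in auto)
  from this[OF ge] have "Inf ?A = 0 \<longleftrightarrow> (\<forall>\<epsilon>>0. Inf ?A < ereal \<epsilon>)" .
  also have "\<dots> \<longleftrightarrow> (\<forall>\<epsilon>>0. \<exists>\<alpha> \<phi>. 0 < \<alpha> \<and> \<alpha> < \<epsilon> \<and> ?P \<alpha> \<phi>)"
    unfolding Inf_less_iff by (intro all_cong) (blast intro: less_ereal.simps(1)[THEN iffD2] dest: less_ereal.simps(1)[THEN iffD1])
  finally show ?thesis unfolding kobayashi_metric_def .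
qed

text \<open>Differentiating \<open>f \<circ> g\<close> at \<open>q\<close> gives
  \<open>D (E v) = v\<close>, so a disc in \<open>U\<close> tangent to \<open>E v\<close> is carried
  by \<open>f\<close> to a disc in \<open>V\<close> tangent to \<open>v\<close> with the same
  \<alpha>.\<close>

lemma kobayashi_metric_eq_0_biholomorphic2:
  assumes "biholomorphic2 U V" "open U" and zero: "\<And>p v. p \<in> U \<Longrightarrow> kobayashi_metric U p v = 0"
    and q: "q \<in> V"
  shows "kobayashi_metric V q v = 0"
  unfolding kobayashi_metric_eq_0_iff
proof (intro allI impI)
  fix \<epsilon> :: real assume "\<epsilon> > 0"
  obtain f g where fg: "holomorphic2_on f U" "holomorphic2_on g V"
    "\<forall>p\<in>U. f p \<in> V" "\<forall>p\<in>V. g p \<in> U"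
    "\<forall>p\<in>U. g (f p) = p" "\<forall>p\<in>V. f (g p) = p"
    by (rule biholomorphic2E[OF assms(1)])
  have oV: "open V" using assms biholomorphic2_open by blast
  obtain D where D: "(f has_derivative D) (at (g q))" "\<forall>c v. D (cscale c v) = cscale c (D v)"
    by (rule holomorphic2_onE[OF fg(1) fg(4)[rule_format, OF q]])
  obtain E where E: "(g has_derivative E) (at q)" "\<forall>c v. E (cscale c v) = cscale c (E v)"
    by (rule holomorphic2_onE[OF fg(2) q])
  have "((f \<circ> g) has_derivative (D \<circ> E)) (at q)"
    using E(1) D(1) by (rule diff_chain_at)
  moreover have "((f \<circ> g) has_derivative id) (at q)"
    by (rule has_derivative_transform_within_open[OF has_derivative_id oV q]) (use fg in auto)
  ultimately have "D \<circ> E = id" by (rule has_derivative_unique)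
  then have DE: "D (E v) = v" by (metis comp_apply id_apply)
  have "kobayashi_metric U (g q) (E v) = 0" using zero fg q by auto
  then obtain \<alpha> \<phi> where a: "0 < \<alpha>" "\<alpha> < \<epsilon>"
    and hol: "(\<lambda>z. fst (\<phi> z)) holomorphic_on ball 0 1" "(\<lambda>z. snd (\<phi> z)) holomorphic_on ball 0 1"
    and im: "\<phi> ` ball 0 1 \<subseteq> U" "\<phi> 0 = g q"
    and der: "cscale (of_real \<alpha>) (deriv (\<lambda>z. fst (\<phi> z)) 0, deriv (\<lambda>z. snd (\<phi> z)) 0) = E v"
    unfolding kobayashi_metric_eq_0_iff using \<open>\<epsilon> > 0\<close> by metis
  note cu = holomorphic2_on_curve[OF fg(1) open_ball hol im(1)]
  have "(deriv (\<lambda>z. fst (f (\<phi> z))) 0, deriv (\<lambda>z. snd (f (\<phi> z))) 0)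
        = D (deriv (\<lambda>z. fst (\<phi> z)) 0, deriv (\<lambda>z. snd (\<phi> z)) 0)"
    using D(1) im(2) by (intro cu(3)) auto
  then have "cscale (of_real \<alpha>) (deriv (\<lambda>z. fst (f (\<phi> z))) 0, deriv (\<lambda>z. snd (f (\<phi> z))) 0) = v"
    using D(2) der DE by metis
  then show "\<exists>\<alpha> \<psi>. 0 < \<alpha> \<and> \<alpha> < \<epsilon> \<and>
        (\<lambda>z. fst (\<psi> z)) holomorphic_on ball 0 1 \<and> (\<lambda>z. snd (\<psi> z)) holomorphic_on ball 0 1 \<and>
        \<psi> ` ball 0 1 \<subseteq> V \<and> \<psi> 0 = q \<and>
        cscale (of_real \<alpha>) (deriv (\<lambda>z. fst (\<psi> z)) 0, deriv (\<lambda>z. snd (\<psi> z)) 0) = v"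
    using a cu(1,2) im fg(3,6) q
    by (intro exI[of _ \<alpha>] exI[of _ "\<lambda>z. f (\<phi> z)"]) auto
qed

section \<open>Increasing unions of balls\<close>

definition ball_exhaustible :: "complex2 set \<Rightarrow> bool" where
  "ball_exhaustible \<Omega> \<longleftrightarrow>
     (\<exists>B :: nat \<Rightarrow> complex2 set.
        incseq B \<and> (\<forall>n. biholomorphic2 (ball 0 1) (B n)) \<and> \<Omega> = (\<Union>n. B n))"

lemma ball_exhaustible_biholomorphic2:
  assumes "ball_exhaustible U" "biholomorphic2 U V"
  shows "ball_exhaustible V"
proof -
  obtain B where B: "incseq B" "\<forall>n. biholomorphic2 (ball 0 1) (B n)" "U = (\<Union>n. B n)"
    using assms(1) unfolding ball_exhaustible_def by blast
  obtain f g where fg: "holomorphic2_on f U" "holomorphic2_on g V"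
    "\<forall>p\<in>U. f p \<in> V" "\<forall>p\<in>V. g p \<in> U" "\<forall>p\<in>U. g (f p) = p" "\<forall>p\<in>V. f (g p) = p"
    by (rule biholomorphic2E[OF assms(2)])
  have sub: "B n \<subseteq> U" for n using B(3) by blast
  have op: "open (B n)" for n
    using biholomorphic2_open[of "ball 0 1" "B n"] B(2) by blast
  have "biholomorphic2 (B n) (f ` B n)" for n
    using fg sub[of n] op[of n]
    by (intro biholomorphic2_restrict[where g = g and U = U and V = V]) blast+
  then have "biholomorphic2 (ball 0 1) (f ` B n)" for n
    using biholomorphic2_trans[of "ball 0 1" "B n"] B(2) open_ball by blast
  moreover have "incseq (\<lambda>n. f ` B n)"
    using B(1) by (auto simp: incseq_def)
  moreover have "V = (\<Union>n. f ` B n)"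
  proof -
    have "V = f ` U" using fg(3,4,6) by force
    then show ?thesis using B(3) by auto
  qed
  ultimately show ?thesis unfolding ball_exhaustible_def by blast
qed

lemma compact_subset_incseqE:
  fixes B :: "nat \<Rightarrow> 'a::topological_space set"
  assumes "compact K" "K \<subseteq> (\<Union>n. B n)" "incseq B" "\<And>n. open (B n)"
  obtains n where "K \<subseteq> B n"
proof -
  obtain C where C: "finite C" "K \<subseteq> (\<Union>n\<in>C. B n)"
    by (rule compactE_image[OF assms(1), of UNIV B]) (use assms in auto)
  have "B n \<subseteq> B (Max C)" if "n \<in> C" for n
    using assms(3) C(1) that by (auto simp: incseq_def)
  then show ?thesis using C(2) that by blast
qed

text \<open>Reduction to the scalar case: pair the curve with its fixed value at \<open>z\<close>.
  The pairing is holomorphic, Cauchy-Schwarz bounds it on the frontier, and at \<open>z\<close> it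
  equals the squared norm.\<close>

lemma maximum_modulus_frontier_complex2:
  assumes hol: "(\<lambda>z. fst (\<phi> z)) holomorphic_on interior S" "(\<lambda>z. snd (\<phi> z)) holomorphic_on interior S"
    and cont: "continuous_on (closure S) \<phi>" and "bounded S" "0 \<le> B"
    and le: "\<And>z. z \<in> frontier S \<Longrightarrow> norm (\<phi> z) \<le> B" and "z \<in> S"
  shows "norm (\<phi> z) \<le> B"
proof -
  define a where "a = fst (\<phi> z)"
  define b where "b = snd (\<phi> z)"
  have CS: "norm (cnj a * c + cnj b * d) \<le> norm (a, b) * norm (c, d)" for c d
  proof -
    have "norm (cnj a * c + cnj b * d) \<le> norm a * norm c + norm b * norm d"
      by (metis complex_mod_cnj norm_mult norm_triangle_ineq)
    also have "\<dots> = inner (norm a, norm b) (norm c, norm d)" by simp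
    also have "\<dots> \<le> norm (norm a, norm b) * norm (norm c, norm d)"
      by (rule norm_cauchy_schwarz)
    finally show ?thesis by (simp add: norm_Pair)
  qed
  let ?F = "\<lambda>w. cnj a * fst (\<phi> w) + cnj b * snd (\<phi> w)"
  have "norm (?F z) \<le> norm (a, b) * B"
  proof (rule maximum_modulus_frontier[of ?F S])
    show "norm (?F w) \<le> norm (a, b) * B" if "w \<in> frontier S" for w
      using CS[of "fst (\<phi> w)" "snd (\<phi> w)"] mult_left_mono[OF le[OF that], of "norm (a, b)"]
      by simp
  qed (use assms in \<open>auto intro!: holomorphic_intros continuous_intros\<close>)
  moreover have "?F z = of_real ((norm (a, b))\<^sup>2)"
  proof -
    have "(norm (a, b))\<^sup>2 = (norm a)\<^sup>2 + (norm b)\<^sup>2" by (simp add: norm_Pair)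
    then show ?thesis
      by (simp only: of_real_add complex_norm_square) (simp add: a_def b_def mult.commute)
  qed
  ultimately have "norm (a, b) * norm (a, b) \<le> norm (a, b) * B"
    by (simp add: norm_mult power2_eq_square)
  then have "norm (a, b) \<le> B"
    using \<open>0 \<le> B\<close> by (metis mult_left_le_imp_le norm_ge_zero order_le_less)
  then show ?thesis by (simp add: a_def b_def)
qed

text \<open>The Kontinuitaetssatz. All the boundaries lie in one ball of the exhaustion, and there the
  maximum principle keeps the members of the family in a fixed compact set.\<close>

lemma continuity_principle:
  fixes \<phi> :: "real \<Rightarrow> complex \<Rightarrow> complex2"
  assumes "ball_exhaustible G" "compact S"
    and cont: "continuous_on ({0..1} \<times> S) (\<lambda>(t, z). \<phi> t z)"
    and hol: "\<And>t. t \<in> {0..1} \<Longrightarrow> (\<lambda>z. fst (\<phi> t z)) holomorphic_on interior S"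
             "\<And>t. t \<in> {0..1} \<Longrightarrow> (\<lambda>z. snd (\<phi> t z)) holomorphic_on interior S"
    and bd: "\<And>t z. t \<in> {0..1} \<Longrightarrow> z \<in> frontier S \<Longrightarrow> \<phi> t z \<in> G"
    and init: "\<And>z. z \<in> S \<Longrightarrow> \<phi> 0 z \<in> G"
    and "z \<in> S"
  shows "\<phi> 1 z \<in> G"
proof -
  obtain B where B: "incseq B" "\<forall>n. biholomorphic2 (ball 0 1) (B n)" "G = (\<Union>n. B n)"
    using assms(1) unfolding ball_exhaustible_def by blast
  have op: "open (B n)" for n
    using biholomorphic2_open[of "ball 0 1" "B n"] B(2) by blast
  have clS: "closure S = S" "closed S" using \<open>compact S\<close> by (simp_all add: compact_imp_closed)
  have frS: "frontier S \<subseteq> S" using clS frontier_subset_closed by blast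
  \<comment> \<open>All boundaries together with the whole initial member: a compact parameter set,
    whose image therefore lies in a single ball of the exhaustion.\<close>
  let ?T = "{0..1::real} \<times> frontier S \<union> {0} \<times> S"
  define K where "K = (\<lambda>(t, z). \<phi> t z) ` ?T"
  have "compact ?T"
    using \<open>compact S\<close> by (intro compact_Un compact_Times compact_frontier) auto
  moreover have "?T \<subseteq> {0..1} \<times> S" using frS by auto
  ultimately have "compact K" unfolding K_def
    using cont continuous_on_subset compact_continuous_image by metis
  moreover have "K \<subseteq> G" using bd init by (auto simp: K_def)
  ultimately obtain n where n: "K \<subseteq> B n"
    using compact_subset_incseqE[of K B] B(1,3) op by metis
  obtain f g where fg: "holomorphic2_on f (ball 0 1)" "holomorphic2_on g (B n)"
    "\<forall>p\<in>ball 0 1. f p \<in> B n" "\<forall>p\<in>B n. g p \<in> ball 0 1" "\<forall>p\<in>ball 0 1. g (f p) = p"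
    "\<forall>p\<in>B n. f (g p) = p"
    using biholomorphic2E B(2) by metis
  have contf: "continuous_on (ball 0 1) f" and contg: "continuous_on (B n) g"
    using fg by (simp_all add: holomorphic2_on_imp_continuous_on)
  obtain \<rho> where \<rho>: "0 \<le> \<rho>" "\<rho> < 1" "\<And>p. p \<in> K \<Longrightarrow> norm (g p) \<le> \<rho>"
  proof (cases "K = {}")
    case False
    have "continuous_on K (\<lambda>p. norm (g p))"
      using continuous_on_subset[OF contg n] by (intro continuous_intros)
    from continuous_attains_sup[OF \<open>compact K\<close> False this]
    obtain p where "p \<in> K" "\<forall>q\<in>K. norm (g q) \<le> norm (g p)" by blast
    moreover have "norm (g p) < 1" using fg(4) n \<open>p \<in> K\<close> by auto
    ultimately show ?thesis using that[of "norm (g p)"] by auto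
  qed (use that[of 0] in auto)
  define H where "H = f ` cball 0 \<rho>"
  have cb: "cball 0 \<rho> \<subseteq> ball (0 :: complex2) 1" using \<rho> by auto
  have "compact H" unfolding H_def
    using continuous_on_subset[OF contf cb] by (intro compact_continuous_image) auto
  moreover have "H \<subseteq> B n" using fg(3) cb by (auto simp: H_def)
  ultimately obtain e where e: "e > 0" "(\<Union>x\<in>H. ball x e) \<subseteq> B n"
    using compact_subset_open_imp_ball_epsilon_subset op by metis
  have stay: "\<phi> t ` S \<subseteq> H" if t: "t \<in> {0..1}" and sub: "\<phi> t ` S \<subseteq> B n" for t
  proof (rule image_subsetI)
    fix w assume w: "w \<in> S"
    have int: "\<phi> t ` interior S \<subseteq> B n" using sub interior_subset by blast
    have "continuous_on S (\<lambda>z. \<phi> t z)"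
      using continuous_on_compose2[OF cont continuous_on_Pair[OF continuous_on_const[of S t]
          continuous_on_id]] t by (auto simp: image_subset_iff)
    then have c: "continuous_on (closure S) (\<lambda>z. g (\<phi> t z))"
      unfolding clS by (rule continuous_on_compose2[OF contg]) (use sub in auto)
    have fr: "norm (g (\<phi> t z)) \<le> \<rho>" if "z \<in> frontier S" for z
      by (rule \<rho>(3)) (use that t in \<open>force simp: K_def\<close>)
    have "norm (g (\<phi> t w)) \<le> \<rho>"
      by (rule maximum_modulus_frontier_complex2[where S = S])
        (use holomorphic2_on_curve(1,2)[OF fg(2) open_interior hol(1,2)[OF t] int] c fr \<rho> w
          \<open>compact S\<close> in \<open>auto simp: compact_imp_bounded\<close>)
    moreover have "\<phi> t w \<in> B n" using sub w by blast
    ultimately show "\<phi> t w \<in> H" unfolding H_def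
      using fg(6) by (intro image_eqI[of _ _ "g (\<phi> t w)"]) auto
  qed
  have "uniformly_continuous_on ({0..1} \<times> S) (\<lambda>(t, z). \<phi> t z)"
    using \<open>compact S\<close> cont by (intro compact_uniformly_continuous compact_Times) auto
  then obtain d where d: "d > 0" "\<And>x y. x \<in> {0..1} \<times> S \<Longrightarrow> y \<in> {0..1} \<times> S \<Longrightarrow> dist y x < d \<Longrightarrow>
      dist (case y of (t, z) \<Rightarrow> \<phi> t z) (case x of (t, z) \<Rightarrow> \<phi> t z) < e"
    using \<open>e > 0\<close> unfolding uniformly_continuous_on_def by meson
  \<comment> \<open>Neither the margin \<open>e\<close> around \<open>H\<close> nor the modulus of
    continuity \<open>d\<close> depends on the parameter, so finitely many steps of equal length
    less than \<open>d\<close> lead from 0 to 1.\<close>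
  have step: "\<phi> t' ` S \<subseteq> B n"
    if "t \<in> {0..1}" "t' \<in> {0..1}" "\<phi> t ` S \<subseteq> B n" "\<bar>t' - t\<bar> < d" for t t'
  proof (rule image_subsetI)
    fix w assume w: "w \<in> S"
    have "dist (\<phi> t' w) (\<phi> t w) < e"
      using d(2)[of "(t, w)" "(t', w)"] that w by (simp add: dist_Pair_Pair dist_real_def)
    moreover have "\<phi> t w \<in> H" using stay that w by blast
    ultimately show "\<phi> t' w \<in> B n" using e(2) by (force simp: dist_commute)
  qed
  obtain N where N: "inverse (real (Suc N)) < d" using reals_Archimedean[OF \<open>d > 0\<close>] by blast
  have "\<phi> (real k / real (Suc N)) ` S \<subseteq> B n" if "k \<le> Suc N" for k
    using that
  proof (induction k)
    case 0
    have "\<phi> 0 w \<in> K" if "w \<in> S" for w using that by (force simp: K_def)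
    then show ?case using n by auto
  next
    case (Suc k)
    have "real (Suc k) / real (Suc N) - real k / real (Suc N) = inverse (real (Suc N))"
      by (simp add: field_simps)
    moreover have "\<phi> (real k / real (Suc N)) ` S \<subseteq> B n" using Suc by simp
    ultimately show ?case using Suc.prems N
      by (intro step[of "real k / real (Suc N)" "real (Suc k) / real (Suc N)"])
        (simp_all add: divide_le_eq del: of_nat_Suc)
  qed
  from this[of "Suc N"] have "\<phi> 1 ` S \<subseteq> B n" by simp
  then show ?thesis using \<open>z \<in> S\<close> B(3) by blast
qed

section \<open>Reinhardt domains\<close>

lemma exp_i_polar: "norm z = 1 \<Longrightarrow> \<exists>t::real. z = exp (\<i> * of_real t)"
  by (metis complex_norm_eq_1_exp)

lemma reinhardtD:
  assumes "reinhardt G" "(x, y) \<in> G" "norm x' = norm x" "norm y' = norm y"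
  shows "(x', y') \<in> G"
proof -
  have "\<exists>t::real. x' = exp (\<i> * of_real t) * x" if eq: "norm x' = norm x" for x x' :: complex
  proof (cases "x = 0")
    case False
    then obtain t :: real where "x' / x = exp (\<i> * of_real t)"
      using exp_i_polar[of "x' / x"] eq by (auto simp: norm_divide)
    with False show ?thesis by (intro exI[of _ t]) (simp add: field_simps)
  qed (use eq in auto)
  then show ?thesis using assms unfolding reinhardt_def by metis
qed

text \<open>Exchanging the coordinates preserves every assumption made on \<open>G\<close>, so
  completeness is proved in the first coordinate and transferred to the second.\<close>

lemma holomorphic2_on_swap: "holomorphic2_on prod.swap U"
  unfolding holomorphic2_on_def
proof
  fix p :: complex2
  have "(prod.swap has_derivative prod.swap) (at p)"
    using bounded_linear.has_derivative[OF bounded_linear_Pair[OF bounded_linear_snd bounded_linear_fst]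
        has_derivative_ident, where F = "at p"]
    by (simp add: prod.swap_def[abs_def])
  then show "\<exists>D. ((prod.swap :: complex2 \<Rightarrow> complex2) has_derivative D) (at p) \<and>
      (\<forall>c v. D (cscale c v) = cscale c (D v))"
    by (intro exI[of _ prod.swap]) (simp add: cscale_def)
qed

lemma ball_exhaustible_swap:
  assumes "ball_exhaustible G" "open G"
  shows "ball_exhaustible (prod.swap ` G)"
  using assms
  by (intro ball_exhaustible_biholomorphic2[OF assms(1)]
      biholomorphic2_restrict[where U = UNIV and V = UNIV and g = prod.swap])
    (auto simp: holomorphic2_on_swap)

lemma reinhardt_swap: "reinhardt G \<Longrightarrow> reinhardt (prod.swap ` G)"
  unfolding reinhardt_def by (auto simp: image_iff prod.swap_def Bex_def split_paired_Ex)

lemma open_swap: "open G \<Longrightarrow> open (prod.swap ` G :: complex2 set)"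
  by (intro invariance_of_domain holomorphic2_on_imp_continuous_on holomorphic2_on_swap) auto

text \<open>Otherwise a logarithm of the first coordinate exists on the ball of the exhaustion
  that contains a rotation orbit, and it would give a continuous argument along that orbit.\<close>

lemma reinhardt_ball_exhaustible_meets_axis:
  assumes "ball_exhaustible G" "reinhardt G" "G \<noteq> {}"
  shows "\<exists>y. (0, y) \<in> G"
proof (rule ccontr)
  assume no: "\<nexists>y. (0, y) \<in> G"
  obtain x y where xy: "(x, y) \<in> G" using assms(3) by fastforce
  then have x0: "x \<noteq> 0" using no by auto
  obtain B where B: "incseq B" "\<forall>n. biholomorphic2 (ball 0 1) (B n)" "G = (\<Union>n. B n)"
    using assms(1) unfolding ball_exhaustible_def by blast
  have op: "open (B n)" for n
    using biholomorphic2_open[of "ball 0 1" "B n"] B(2) by blast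
  let ?l = "\<lambda>t::real. (exp (\<i> * of_real t) * x, y)"
  have cl: "continuous_on A ?l" for A by (intro continuous_intros)
  have "?l ` {0..2*pi} \<subseteq> G"
    using reinhardtD[OF assms(2) xy] by (auto simp: norm_mult)
  moreover have "compact (?l ` {0..2*pi})"
    using cl by (intro compact_continuous_image) auto
  ultimately obtain n where n: "?l ` {0..2*pi} \<subseteq> B n"
    using compact_subset_incseqE[of "?l ` {0..2*pi}" B] B(1,3) op by metis
  obtain f g where fg: "holomorphic2_on f (ball 0 1)" "holomorphic2_on g (B n)"
    "\<forall>p\<in>ball 0 1. f p \<in> B n" "\<forall>p\<in>B n. g p \<in> ball 0 1" "\<forall>p\<in>ball 0 1. g (f p) = p"
    "\<forall>p\<in>B n. f (g p) = p"
    using biholomorphic2E B(2) by metis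
  have "continuous_on (ball 0 1) (\<lambda>p. fst (f p))"
    using fg(1) by (intro continuous_intros holomorphic2_on_imp_continuous_on)
  moreover have "fst (f p) \<noteq> 0" if "p \<in> ball 0 1" for p
    using fg(3) that no B(3) by (metis UN_I UNIV_I prod.collapse)
  ultimately obtain L where L: "continuous_on (ball 0 1) L" "\<And>p. p \<in> ball 0 1 \<Longrightarrow> fst (f p) = exp (L p)"
    using continuous_logarithm_on_ball[of 0 1 "\<lambda>p. fst (f p)"] by blast
  \<comment> \<open>Subtracting the angle makes \<open>exp (?h t)\<close> the constant
    \<open>x\<close>, so \<open>?h\<close> is continuous with discrete range, hence constant. But
    the loop \<open>?l\<close> closes up, so \<open>?h\<close> would have to change by -2 pi
    i.\<close>
  let ?h = "\<lambda>t. L (g (?l t)) - \<i> * of_real t"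
  have cg: "continuous_on {0..2*pi} (\<lambda>t. g (?l t))"
    by (rule continuous_on_compose2[OF holomorphic2_on_imp_continuous_on[OF fg(2)] cl n])
  have cL: "continuous_on {0..2*pi} (\<lambda>t. L (g (?l t)))"
    by (rule continuous_on_compose2[OF L(1) cg]) (use fg(4) n in blast)
  then have ch: "continuous_on {0..2*pi} ?h"
    by (intro continuous_intros)
  have e: "exp (?h t) = x" if "t \<in> {0..2*pi}" for t
  proof -
    have "?l t \<in> B n" using n that by blast
    then have "exp (L (g (?l t))) = fst (?l t)" using L(2) fg(4,6) by metis
    then show ?thesis by (simp add: exp_diff)
  qed
  define h where "h = ?h"
  have "h constant_on {0..2*pi}"
  proof (rule continuous_discrete_range_constant)
    show "continuous_on {0..2*pi} h" using ch by (simp add: h_def)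
    fix t assume t: "t \<in> {0..2*pi}"
    have "1 \<le> norm (h s - h t)" if s: "s \<in> {0..2*pi}" "h s \<noteq> h t" for s
    proof (rule ccontr)
      assume "\<not> 1 \<le> norm (h s - h t)"
      then have "\<bar>Im (h s - h t)\<bar> < 1" using abs_Im_le_cmod[of "h s - h t"] by linarith
      then have "\<bar>Im (h s) - Im (h t)\<bar> < 2 * pi"
        using pi_gt3 by simp
      moreover have "exp (h s) = exp (h t)" using e[OF s(1)] e[OF t] by (simp add: h_def)
      ultimately have "h s = h t" by (rule exp_complex_eqI)
      with s show False by blast
    qed
    then show "\<exists>e>0. \<forall>s. s \<in> {0..2*pi} \<and> h s \<noteq> h t \<longrightarrow> e \<le> norm (h s - h t)"
      by (intro exI[of _ 1]) auto
  qed auto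
  then obtain c where "\<And>t. t \<in> {0..2*pi} \<Longrightarrow> h t = c" unfolding constant_on_def by blast
  from this[of 0] this[of "2*pi"] have "h 0 = h (2*pi)" by simp
  moreover have "exp (\<i> * of_real (2*pi)) = 1" by (simp add: exp_eq_1)
  ultimately show False by (simp add: h_def)
qed

text \<open>Along a path from a point of the axis to \<open>(x, y)\<close>, each point spans the
  disc obtained by multiplying its first coordinate by \<open>z\<close> with |z| <= 1. The
  boundaries are rotations of points of \<open>G\<close>, and the initial disc is a single
  point.\<close>

lemma reinhardt_complete_fst:
  assumes "ball_exhaustible G" "reinhardt G" "open G" "connected G"
    and xy: "(x, y) \<in> G" and "norm z \<le> 1"
  shows "(z * x, y) \<in> G"
proof -
  obtain y0 where y0: "(0, y0) \<in> G"
    using reinhardt_ball_exhaustible_meets_axis assms by blast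
  have "path_connected G" using assms by (simp add: connected_open_path_connected)
  then obtain \<gamma> where \<gamma>: "path \<gamma>" "path_image \<gamma> \<subseteq> G" "pathstart \<gamma> = (0, y0)" "pathfinish \<gamma> = (x, y)"
    using y0 xy unfolding path_connected_def by blast
  let ?\<phi> = "\<lambda>t z. (z * fst (\<gamma> t), snd (\<gamma> t))"
  have "?\<phi> 1 z \<in> G"
  proof (rule continuity_principle[OF assms(1), where S = "cball 0 1" and \<phi> = ?\<phi>])
    have "continuous_on ({0..1} \<times> cball (0::complex) 1) (\<lambda>q. \<gamma> (fst q))"
      using \<gamma>(1) unfolding path_def
      by (rule continuous_on_compose2) (auto intro!: continuous_intros)
    then show "continuous_on ({0..1} \<times> cball 0 1) (\<lambda>(t, z). ?\<phi> t z)"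
      by (auto simp: case_prod_unfold intro!: continuous_intros)
    fix t :: real assume t: "t \<in> {0..1}"
    then have "\<gamma> t \<in> G" using \<gamma>(2) by (auto simp: path_image_def)
    then show "?\<phi> t w \<in> G" if "w \<in> frontier (cball 0 1)" for w
      using that reinhardtD[OF assms(2), of "fst (\<gamma> t)" "snd (\<gamma> t)"] by (simp add: norm_mult)
  qed (use \<gamma>(3) y0 \<open>norm z \<le> 1\<close> in \<open>auto simp: pathstart_def intro!: holomorphic_intros\<close>)
  then show ?thesis using \<gamma>(4) by (simp add: pathfinish_def)
qed

lemma reinhardt_complete:
  assumes "ball_exhaustible G" "reinhardt G" "open G" "connected G"
    and xy: "(x, y) \<in> G" and "norm x' \<le> norm x" "norm y' \<le> norm y"
  shows "(x', y') \<in> G"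
proof -
  have scale: "\<exists>z::complex. norm z \<le> 1 \<and> x' = z * x" if "norm x' \<le> norm x" for x x' :: complex
    using that by (cases "x = 0") (auto intro!: exI[of _ "x' / x"] simp: norm_divide divide_le_eq)
  obtain z w where zw: "norm z \<le> 1" "x' = z * x" "norm w \<le> 1" "y' = w * y"
    using scale assms by metis
  let ?G = "prod.swap ` G"
  have "(x', y) \<in> G" using reinhardt_complete_fst[OF assms(1-4) xy zw(1)] zw(2) by simp
  then have "(y, x') \<in> ?G" by force
  moreover have "connected ?G"
    using assms(4) by (intro connected_continuous_image holomorphic2_on_imp_continuous_on
        holomorphic2_on_swap)
  ultimately have "(y', x') \<in> ?G"
    using reinhardt_complete_fst[of ?G y x' w] zw assms
      ball_exhaustible_swap reinhardt_swap open_swap by blast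
  then show ?thesis by auto
qed

text \<open>Testing positive real points suffices because membership in a Reinhardt set depends on
  moduli only. Points on the axes leave no trace here; \<open>log_image_dominates\<close> takes care
  of them.\<close>

definition log_image :: "complex2 set \<Rightarrow> (real \<times> real) set" where
  "log_image G = {(a, b). (of_real (exp a), of_real (exp b)) \<in> G}"

section \<open>Logarithmic convexity and the supporting half plane\<close>

context
  fixes G :: "complex2 set"
  assumes G: "ball_exhaustible G" "reinhardt G" "open G" "connected G"
begin

lemma log_image_mono:
  assumes "(a, b) \<in> log_image G" "a' \<le> a" "b' \<le> b"
  shows "(a', b') \<in> log_image G"
  using reinhardt_complete[OF G] assms by (auto simp: log_image_def)

text \<open>The monomial curve with coordinates proportional to \<open>z ^ m\<close> and
  \<open>inverse (z ^ k)\<close> maps the two circles bounding the annulus 1 <= |z| <= exp T over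
  the two given points, and the circle of radius exp (\<theta> T) over the point between them.
  Single-valuedness forces integer exponents, hence a rational slope.\<close>

lemma log_image_annulus:
  fixes m k :: nat
  assumes p: "(p1, p2) \<in> log_image G" and q: "(p1 + real m * T, p2 - real k * T) \<in> log_image G"
    and T: "0 \<le> T" and \<theta>: "0 \<le> \<theta>" "\<theta> \<le> 1"
  shows "(p1 + \<theta> * (real m * T), p2 - \<theta> * (real k * T)) \<in> log_image G"
proof -
  let ?S = "{z::complex. 1 \<le> norm z \<and> norm z \<le> exp T}"
  have S: "closed ?S"
    by (intro closed_Collect_conj closed_Collect_le continuous_intros)
  have "bounded ?S" by (rule boundedI[of _ "exp T"]) auto
  then have "compact ?S" using S by (simp add: compact_eq_bounded_closed)
  have "{z::complex. 1 < norm z \<and> norm z < exp T} \<subseteq> interior ?S"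
    by (intro interior_maximal open_Collect_conj open_Collect_less continuous_intros) auto
  then have fr: "norm z = 1 \<or> norm z = exp T" "z \<in> ?S" if "z \<in> frontier ?S" for z
    using that S unfolding frontier_def by force+
  \<comment> \<open>The family is the curve shrunk by the factor \<open>?c t\<close>. With this
    \<open>s\<close> the factor at \<open>t = 0\<close> outweighs both \<open>z ^ m\<close> and the
    drop \<open>k * T\<close>, so the initial member lies below one point of
    \<open>log_image G\<close>; at \<open>t = 1\<close> the factor is 1.\<close>
  define s where "s = real (m + k) * T"
  let ?c = "\<lambda>t. exp (- ((1 - t) * s))"
  let ?\<phi> = "\<lambda>t z. (complex_of_real (?c t * exp p1) * z ^ m, complex_of_real (?c t * exp p2) * inverse (z ^ k))"
  have s: "0 \<le> s" "real m * T \<le> s" "real k * T \<le> s"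
    using T by (auto simp: s_def intro!: mult_right_mono)
  have mem: "?\<phi> t z \<in> G" if "(a, b) \<in> log_image G" "?c t * exp p1 * norm z ^ m \<le> exp a"
    "?c t * exp p2 * inverse (norm z ^ k) \<le> exp b" for a b t z
    using that reinhardt_complete[OF G, of "of_real (exp a)" "of_real (exp b)" "fst (?\<phi> t z)" "snd (?\<phi> t z)"]
    by (simp add: log_image_def norm_mult norm_power norm_inverse)
  have c1: "?c t \<le> 1" if "t \<in> {0..1}" for t using that s by simp
  have eT: "exp T ^ n = exp (real n * T)" for n by (simp add: exp_of_nat_mult)
  have "?\<phi> 1 (of_real (exp (\<theta> * T))) \<in> G"
  proof (rule continuity_principle[OF G(1) \<open>compact ?S\<close>, where \<phi> = ?\<phi>])
    show "continuous_on ({0..1} \<times> ?S) (\<lambda>(t, z). ?\<phi> t z)"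
      unfolding case_prod_unfold by (intro continuous_intros) auto
    have "0 \<notin> interior ?S" using interior_subset[of ?S] by auto
    then show "(\<lambda>z. fst (?\<phi> t z)) holomorphic_on interior ?S"
      "(\<lambda>z. snd (?\<phi> t z)) holomorphic_on interior ?S" for t
      by (auto intro!: holomorphic_intros)
  next
    fix t z assume t: "t \<in> {0..1::real}" and z: "z \<in> frontier ?S"
    from fr(1)[OF z] show "?\<phi> t z \<in> G"
    proof
      assume "norm z = 1"
      then show ?thesis using c1[OF t] by (intro mem[OF p]) auto
    next
      assume "norm z = exp T"
      then show ?thesis using c1[OF t]
        by (intro mem[OF q]) (auto simp: eT exp_add exp_diff divide_inverse mult.assoc)
    qed
  next
    fix z assume z: "z \<in> ?S"
    have "(p1, p2 - real k * T) \<in> log_image G"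
      using T by (intro log_image_mono[OF p]) auto
    moreover have "?c 0 * exp p1 * norm z ^ m \<le> exp p1"
    proof -
      have "norm z ^ m \<le> exp s"
        using power_mono[of "norm z" "exp T" m] z s(2) by (simp add: eT)
          (meson dual_order.trans exp_le_cancel_iff)
      then show ?thesis by (simp add: exp_minus divide_simps)
    qed
    moreover have "?c 0 * exp p2 * inverse (norm z ^ k) \<le> exp (p2 - real k * T)"
    proof -
      have "inverse (norm z ^ k) \<le> 1" using z by (simp add: inverse_le_1_iff)
      moreover have "?c 0 * exp p2 \<le> exp (p2 - real k * T)"
        using s(3) by (simp flip: exp_add)
      ultimately show ?thesis
        using mult_mono[of "?c 0 * exp p2" "exp (p2 - real k * T)" "inverse (norm z ^ k)" 1] by simp
    qed
    ultimately show "?\<phi> 0 z \<in> G" by (rule mem)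
  next
    show "of_real (exp (\<theta> * T)) \<in> ?S"
      using \<theta> T by (auto simp: mult_left_le_one_le)
  qed
  moreover have "exp (\<theta> * T) ^ n = exp (\<theta> * (real n * T))" for n
    by (simp add: mult_ac flip: exp_of_nat_mult)
  ultimately show ?thesis
    by (simp add: log_image_def exp_add exp_diff divide_inverse flip: of_real_power of_real_inverse of_real_mult)
qed

lemma open_log_image: "open (log_image G)"
proof -
  have "log_image G = (\<lambda>p. (of_real (exp (fst p)), of_real (exp (snd p)))) -` G"
    by (auto simp: log_image_def)
  also have "open \<dots>"
    using G(3) by (intro open_vimage continuous_intros)
  finally show ?thesis .
qed

text \<open>A slight increase of \<open>q\<^sub>1\<close>, harmless by monotonicity, makes the slope rational.\<close>

lemma log_image_segment:
  assumes p: "(p1, p2) \<in> log_image G" and q: "(q1, q2) \<in> log_image G"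
    and less: "p1 < q1" "q2 < p2" and \<theta>: "0 \<le> \<theta>" "\<theta> \<le> 1"
  shows "((1 - \<theta>) * p1 + \<theta> * q1, (1 - \<theta>) * p2 + \<theta> * q2) \<in> log_image G"
proof -
  obtain e where e: "e > 0" "ball (q1, q2) e \<subseteq> log_image G"
    using open_log_image q open_contains_ball by blast
  let ?d = "p2 - q2"
  have "(q1 - p1) / ?d < (q1 - p1 + e) / ?d"
    using e less by (simp add: divide_strict_right_mono)
  then obtain r where r: "r \<in> \<rat>" "(q1 - p1) / ?d < r" "r < (q1 - p1 + e) / ?d"
    using Rats_dense_in_real by blast
  have "0 < (q1 - p1) / ?d" using less by simp
  then have "0 < r" using r by linarith
  obtain m k :: nat where mk: "k \<noteq> 0" "\<bar>r\<bar> = real m / real k"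
    using Rats_abs_nat_div_natE[OF r(1)] by metis
  \<comment> \<open>With \<open>r = m / k\<close> this makes \<open>k * T\<close> exactly the drop
    of the second coordinate, while \<open>m * T = r * ?d\<close> overshoots \<open>q1 - p1\<close>
    by less than \<open>e\<close>.\<close>
  define T where "T = ?d / real k"
  have T: "0 \<le> T" "real k * T = ?d" "real m * T = r * ?d"
    using less mk \<open>0 < r\<close> by (simp_all add: T_def)
  have r': "q1 - p1 < r * ?d" "r * ?d < q1 - p1 + e"
    using r less by (simp_all add: field_simps)
  then have "(p1 + r * ?d, q2) \<in> ball (q1, q2) e"
    by (simp add: dist_Pair_Pair dist_real_def)
  then have "(p1 + real m * T, p2 - real k * T) \<in> log_image G"
    using e T by auto
  from log_image_annulus[OF p this T(1) \<theta>]
  have "(p1 + \<theta> * (r * ?d), p2 - \<theta> * ?d) \<in> log_image G" using T by simp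
  then show ?thesis
  proof (rule log_image_mono)
    show "(1 - \<theta>) * p1 + \<theta> * q1 \<le> p1 + \<theta> * (r * ?d)"
      using mult_left_mono[OF less_imp_le[OF r'(1)] \<theta>(1)] by (simp add: algebra_simps)
  qed (simp add: algebra_simps)
qed

text \<open>Only when the two coordinates move in opposite directions is the annulus argument
  required. Otherwise one endpoint dominates the whole segment and monotonicity suffices.\<close>

lemma convex_log_image: "convex (log_image G)"
proof (rule convexI, clarify)
  fix p1 p2 q1 q2 u v :: real
  assume p: "(p1, p2) \<in> log_image G" and q: "(q1, q2) \<in> log_image G"
    and uv: "0 \<le> u" "0 \<le> v" "u + v = 1"
  have u: "u = 1 - v" and v: "v = 1 - u" using uv by auto
  have bound: "u * a + v * b \<le> c" if "a \<le> c" "b \<le> c" for a b c :: real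
    using convex_bound_le[OF that uv] .
  consider "p1 < q1" "q2 < p2" | "q1 < p1" "p2 < q2" | "p1 \<le> q1" "p2 \<le> q2" | "q1 \<le> p1" "q2 \<le> p2"
    by linarith
  then show "u *\<^sub>R (p1, p2) + v *\<^sub>R (q1, q2) \<in> log_image G"
  proof cases
    case 1
    then show ?thesis using log_image_segment[OF p q, of v] uv unfolding u by simp
  next
    case 2
    then show ?thesis using log_image_segment[OF q p, of u] uv unfolding v
      by (simp add: add.commute)
  next
    case 3
    then show ?thesis using log_image_mono[OF q] bound by auto
  next
    case 4
    then show ?thesis using log_image_mono[OF p] bound by auto
  qed
qed

text \<open>A point with a zero coordinate has no logarithm, but openness allows it to be moved off
  the axes without decreasing either modulus. Bounds on \<open>log_image G\<close> thus become
  bounds at every point of \<open>G\<close>.\<close>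

lemma log_image_dominates:
  assumes "(x0, y0) \<in> G"
  obtains s t where "(s, t) \<in> log_image G" "norm x0 \<le> exp s" "norm y0 \<le> exp t"
proof -
  obtain e where e: "e > 0" "ball (x0, y0) e \<subseteq> G" using G(3) assms open_contains_ball by blast
  have near: "\<exists>x1. x1 \<noteq> 0 \<and> norm x \<le> norm x1 \<and> dist x x1 < e / 2" for x :: complex
  proof (cases "x = 0")
    case True
    then show ?thesis using e(1) by (intro exI[of _ "of_real (e / 4)"]) simp
  qed (use e(1) in \<open>auto intro!: exI[of _ x]\<close>)
  obtain x1 y1 where xy1: "x1 \<noteq> 0" "norm x0 \<le> norm x1" "dist x0 x1 < e / 2" "y1 \<noteq> 0" "norm y0 \<le> norm y1" "dist y0 y1 < e / 2"
    using near by metis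
  have "dist (x0, y0) (x1, y1) \<le> dist x0 x1 + dist y0 y1"
    by (simp add: dist_Pair_Pair sqrt_sum_squares_le_sum)
  then have "(x1, y1) \<in> G" using e xy1 by force
  then have "(of_real (norm x1), of_real (norm y1)) \<in> G"
    by (rule reinhardtD[OF G(2)]) auto
  then have "(ln (norm x1), ln (norm y1)) \<in> log_image G"
    using xy1 by (simp add: log_image_def)
  then show ?thesis by (rule that) (use xy1 in auto)
qed

text \<open>Separate the convex logarithmic image from a point outside it. The coefficients are
  nonnegative because the image is closed under decreasing either coordinate.\<close>

lemma log_image_half_plane:
  assumes "G \<noteq> UNIV" "G \<noteq> {}"
  obtains a b d where "a \<ge> 0" "b \<ge> 0" "a + b > 0"
    "\<And>s t. (s, t) \<in> log_image G \<Longrightarrow> a * s + b * t \<le> d"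
proof -
  obtain x y where "(x, y) \<notin> G" using assms(1) by auto
  \<comment> \<open>Adding 1 makes both moduli positive, so that logarithms exist, and still
    dominates the missing point; completeness then excludes the larger point as well.\<close>
  have "(ln (norm x + 1), ln (norm y + 1)) \<notin> log_image G"
  proof
    assume "(ln (norm x + 1), ln (norm y + 1)) \<in> log_image G"
    then have "(of_real (norm x + 1), of_real (norm y + 1)) \<in> G"
      by (simp add: log_image_def add_nonneg_pos)
    then have "(x, y) \<in> G"
      by (rule reinhardt_complete[OF G]) (simp_all add: norm_of_real del: of_real_add)
    with \<open>(x, y) \<notin> G\<close> show False ..
  qed
  then obtain P where P: "P \<notin> log_image G" by blast
  obtain x0 y0 where xy0: "(x0, y0) \<in> G" using assms(2) by auto
  then obtain s0 t0 where st: "(s0, t0) \<in> log_image G" using log_image_dominates by blast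
  obtain c d where c: "c \<noteq> 0" "\<And>x. x \<in> log_image G \<Longrightarrow> inner c x \<le> d"
    using separating_hyperplane_sets[OF convex_log_image convex_singleton, of P] P st by force
  obtain a b where ab: "c = (a, b)" by fastforce
  have le: "a * s + b * t \<le> d" if "(s, t) \<in> log_image G" for s t
    using c(2)[OF that] by (simp add: ab)
  have "0 \<le> a"
  proof (rule ccontr)
    assume "\<not> 0 \<le> a"
    then have "a < 0" by simp
    \<comment> \<open>If \<open>a\<close> were negative, a point this far to the left would give the
      linear form a value of at least \<open>d + 1\<close>.\<close>
    let ?s = "min s0 ((d - b * t0 + 1) / a)"
    have "a * ?s + b * t0 \<le> d" using le log_image_mono[OF st] by simp
    moreover have "a * ((d - b * t0 + 1) / a) \<le> a * ?s"
      using \<open>a < 0\<close> by (intro mult_left_mono_neg) auto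
    moreover have "a * ((d - b * t0 + 1) / a) = d - b * t0 + 1" using \<open>a < 0\<close> by simp
    ultimately show False by linarith
  qed
  moreover have "0 \<le> b"
  proof (rule ccontr)
    assume "\<not> 0 \<le> b"
    then have "b < 0" by simp
    let ?t = "min t0 ((d - a * s0 + 1) / b)"
    have "a * s0 + b * ?t \<le> d" using le log_image_mono[OF st] by simp
    moreover have "b * ((d - a * s0 + 1) / b) \<le> b * ?t"
      using \<open>b < 0\<close> by (intro mult_left_mono_neg) auto
    moreover have "b * ((d - a * s0 + 1) / b) = d - a * s0 + 1" using \<open>b < 0\<close> by simp
    ultimately show False by linarith
  qed
  moreover have "a + b > 0" using calculation c(1) ab by (auto simp: zero_prod_def)
  ultimately show ?thesis using le that by blast
qed

end

section \<open>A Schwarz lemma for monomials with real exponents\<close>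

text \<open>Power trick: a multiplicative loss \<open>M\<close> that does not grow with
  \<open>n\<close> disappears on taking n-th roots.\<close>

lemma le_of_power_le_mult:
  fixes V C M :: real
  assumes "0 \<le> V" "0 < C" "\<And>n. n > 0 \<Longrightarrow> V ^ n \<le> C ^ n * M"
  shows "V \<le> C"
proof (rule ccontr)
  assume "\<not> V \<le> C"
  then have "1 < V / C" using assms by simp
  then obtain n where n: "M < (V / C) ^ n" using real_arch_pow by blast
  also have "\<dots> \<le> (V / C) ^ Suc n" using \<open>1 < V / C\<close> by (intro power_increasing) auto
  also have "\<dots> \<le> M"
    using assms(3)[of "Suc n"] assms(2) by (simp add: power_divide divide_le_eq mult.commute del: power_Suc)
  finally show False by simp
qed

text \<open>The exponents are approximated by rational ones, for which \<open>f ^ m * g ^ k\<close> is holomorphic.\<close>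

lemma maximum_modulus_powr:
  fixes f g :: "complex \<Rightarrow> complex"
  assumes hol: "f holomorphic_on interior S" "g holomorphic_on interior S"
    and cont: "continuous_on (closure S) f" "continuous_on (closure S) g"
    and "bounded S" and pos: "0 < a" "0 < b" "0 < C"
    and le: "\<And>z. z \<in> frontier S \<Longrightarrow> norm (f z) powr a * norm (g z) powr b \<le> C"
    and z: "z \<in> S"
  shows "norm (f z) powr a * norm (g z) powr b \<le> C"
proof (cases "f z = 0 \<or> g z = 0")
  case False
  have cS: "compact (closure S)" using \<open>bounded S\<close> by (simp add: compact_closure)
  have "bounded (f ` closure S)" "bounded (g ` closure S)"
    by (intro compact_imp_bounded compact_continuous_image cont cS)+
  then obtain N1 N2 where N12: "\<And>w. w \<in> closure S \<Longrightarrow> norm (f w) \<le> N1" "\<And>w. w \<in> closure S \<Longrightarrow> norm (g w) \<le> N2"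
    unfolding bounded_iff by (metis imageI)
  define N where "N = max 1 (max N1 N2)"
  have N: "1 \<le> N" "\<And>w. w \<in> closure S \<Longrightarrow> norm (f w) \<le> N" "\<And>w. w \<in> closure S \<Longrightarrow> norm (g w) \<le> N"
    using N12 unfolding N_def by force+
  \<comment> \<open>\<open>K\<close> bounds the reciprocals of the two nonzero values at
    \<open>z\<close>; if one value vanishes, the claim is trivial because
    \<open>0 powr a = 0\<close>.\<close>
  define K where "K = max 1 (max (1 / norm (f z)) (1 / norm (g z)))"
  have up: "t ^ m \<le> t powr c * N" if "0 \<le> t" "t \<le> N" "0 < c" "c \<le> real m" "real m \<le> c + 1" for t c m
  proof (cases "t = 0")
    case True
    then show ?thesis using that by (cases m) auto
  next
    case False
    then have "t > 0" using that by simp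
    have "t ^ m = t powr c * t powr (real m - c)"
      using \<open>t > 0\<close> by (simp add: powr_realpow flip: powr_add)
    moreover have "t powr (real m - c) \<le> N powr (real m - c)"
      using that \<open>t > 0\<close> by (intro powr_mono2) auto
    moreover have "N powr (real m - c) \<le> N powr 1"
      using that N by (intro powr_mono) auto
    ultimately show ?thesis using N by (simp add: mult_left_mono)
  qed
  have down: "t powr c \<le> t ^ m * K" if "0 < t" "1 / t \<le> K" "c \<le> real m" "real m \<le> c + 1" for t c m
  proof -
    have "t powr c = t ^ m * (1 / t) powr (real m - c)"
      using that(1) by (simp add: powr_realpow powr_divide powr_diff)
    moreover have "(1 / t) powr (real m - c) \<le> K powr (real m - c)"
      using that by (intro powr_mono2) auto
    moreover have "K powr (real m - c) \<le> K powr 1"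
      using that by (intro powr_mono) (auto simp: K_def)
    moreover have "K powr 1 = K" by (simp add: K_def)
    ultimately show ?thesis using that by (simp add: mult_left_mono)
  qed
  \<comment> \<open>Rounding \<open>n * a\<close> and \<open>n * b\<close> up to integers costs a
    factor \<open>N\<close> for each function on the frontier and a factor \<open>K\<close> for each
    at \<open>z\<close>, whatever \<open>n\<close> is.\<close>
  have *: "(norm (f z) powr a * norm (g z) powr b) ^ n \<le> C ^ n * (N * N * (K * K))" if n: "n > 0" for n
  proof -
    define m where "m = nat \<lceil>real n * a\<rceil>"
    define k where "k = nat \<lceil>real n * b\<rceil>"
    have na: "0 < real n * a" "0 < real n * b" using n pos by auto
    have m: "real n * a \<le> real m" "real m \<le> real n * a + 1"
      and k: "real n * b \<le> real k" "real k \<le> real n * b + 1"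
      using na unfolding m_def k_def by linarith+
    have pw: "(t powr c) ^ n = t powr (real n * c)" if "0 \<le> t" for t c :: real
      using that n by (cases "t = 0") (auto simp: powr_powr powr_realpow[symmetric] mult.commute)
    have "norm (f z ^ m * g z ^ k) \<le> C ^ n * (N * N)"
    proof (rule maximum_modulus_frontier[where S = S and f = "\<lambda>w. f w ^ m * g w ^ k"])
      fix w assume w: "w \<in> frontier S"
      then have wc: "w \<in> closure S" by (simp add: frontier_def)
      have "norm (f w ^ m * g w ^ k) \<le> (norm (f w) powr (real n * a) * N) * (norm (g w) powr (real n * b) * N)"
        unfolding norm_mult norm_power using N na m k wc by (intro mult_mono up) auto
      also have "\<dots> = (norm (f w) powr a * norm (g w) powr b) ^ n * (N * N)"
        by (simp add: power_mult_distrib pw)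
      also have "\<dots> \<le> C ^ n * (N * N)"
        using le[OF w] N by (intro mult_right_mono power_mono) auto
      finally show "norm (f w ^ m * g w ^ k) \<le> C ^ n * (N * N)" .
    qed (use assms in \<open>auto intro!: holomorphic_intros continuous_intros\<close>)
    then have le1: "norm (f z) ^ m * norm (g z) ^ k \<le> C ^ n * (N * N)"
      by (simp add: norm_mult norm_power)
    have "(norm (f z) powr a * norm (g z) powr b) ^ n
        = norm (f z) powr (real n * a) * norm (g z) powr (real n * b)"
      by (simp add: power_mult_distrib pw)
    also have "\<dots> \<le> (norm (f z) ^ m * K) * (norm (g z) ^ k * K)"
      using m k False by (intro mult_mono down) (auto simp: K_def)
    also have "\<dots> = (norm (f z) ^ m * norm (g z) ^ k) * (K * K)" by simp
    also have "\<dots> \<le> C ^ n * (N * N) * (K * K)"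
      by (intro mult_right_mono le1) simp
    finally show ?thesis by (simp add: mult.assoc)
  qed
  show ?thesis
    by (rule le_of_power_le_mult[OF _ pos(3) *]) simp_all
qed (use pos in auto)

text \<open>Dividing out the Blaschke factor of the disc of radius \<open>1/2\<close> at a zero \<open>\<alpha>\<close> keeps the bound on
  the circle, hence at the origin by the maximum principle.\<close>

lemma zero_far_from_origin:
  fixes f g :: "complex \<Rightarrow> complex"
  assumes hol: "f holomorphic_on ball 0 1" "g holomorphic_on ball 0 1"
    and pos: "0 < a" "0 < b" "0 < C"
    and le: "\<And>z. z \<in> ball 0 1 \<Longrightarrow> norm (f z) powr a * norm (g z) powr b \<le> C"
    and nz: "f 0 \<noteq> 0" "g 0 \<noteq> 0" and \<alpha>: "f \<alpha> = 0" "norm \<alpha> < 1/2"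
  shows "(norm (f 0) powr a * norm (g 0) powr b / C) powr (1 / a) \<le> 2 * norm \<alpha>"
proof -
  have \<alpha>0: "\<alpha> \<noteq> 0" using nz \<alpha> by auto
  \<comment> \<open>The quotient \<open>f z / (z - \<alpha>)\<close> with its removable singularity
    filled in; the subtracted term vanishes as \<open>f \<alpha> = 0\<close> and gives the shape
    treated by \<open>pole_theorem_open\<close>.\<close>
  define k where "k = (\<lambda>z. if z = \<alpha> then deriv f \<alpha> else f z / (z - \<alpha>) - f \<alpha> / (z - \<alpha>))"
  have k: "k holomorphic_on ball 0 1" unfolding k_def
    by (rule pole_theorem_open[OF hol(1)]) auto
  \<comment> \<open>On |z| = 1/2 one has z * cnj z = 1/4, so |1/4 - cnj \<alpha> * z| = |z -
    \<alpha>| / 2 and the factor 2 makes |h| = |f| there. At the origin |h 0| = |f 0| / (2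
    |\<alpha>|), which is large for \<alpha> near 0.\<close>
  define h where "h = (\<lambda>z. k z * ((1/4 - cnj \<alpha> * z) * 2))"
  have h: "h holomorphic_on ball 0 1" unfolding h_def
    by (intro holomorphic_intros k)
  have sub: "interior (cball (0::complex) (1/2)) \<subseteq> ball 0 1" "closure (cball (0::complex) (1/2)) \<subseteq> ball 0 1"
    by auto
  have "norm (h 0) powr a * norm (g 0) powr b \<le> C"
  proof (rule maximum_modulus_powr[where S = "cball 0 (1/2)" and f = h and g = g and z = 0])
    show "continuous_on (closure (cball 0 (1/2))) h" "continuous_on (closure (cball 0 (1/2))) g"
      using h hol(2) sub(2) by (blast intro: holomorphic_on_imp_continuous_on holomorphic_on_subset)+
    fix z :: complex assume "z \<in> frontier (cball 0 (1/2))"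
    then have z: "norm z = 1/2" by simp
    then have za: "z \<noteq> \<alpha>" using \<alpha> by auto
    have "z * cnj z = of_real ((1/2)\<^sup>2)" using complex_norm_square[of z] z by simp
    then have "z * cnj z = 1/4" by (simp add: power2_eq_square)
    then have "1/4 - cnj \<alpha> * z = z * cnj (z - \<alpha>)" by (simp add: algebra_simps)
    then have "norm ((1/4 - cnj \<alpha> * z) * 2) = norm (z - \<alpha>)"
      using z by (simp add: norm_mult del: complex_cnj_diff)
    moreover have "norm (k z) = norm (f z) / norm (z - \<alpha>)"
      using za \<alpha> by (simp add: k_def norm_divide)
    ultimately have "norm (h z) = norm (f z)"
      using za unfolding h_def norm_mult[of "k z"] by simp
    then show "norm (h z) powr a * norm (g z) powr b \<le> C" using le[of z] z by simp
  qed (use pos h hol sub in \<open>auto intro: holomorphic_on_subset\<close>)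
  moreover have "norm (h 0) = norm (f 0) / (2 * norm \<alpha>)"
    using \<alpha> \<alpha>0 by (simp add: h_def k_def norm_divide norm_mult)
  ultimately have "norm (f 0) powr a / (2 * norm \<alpha>) powr a * norm (g 0) powr b \<le> C"
    using \<alpha>0 by (simp add: powr_divide)
  then have "norm (f 0) powr a * norm (g 0) powr b / C \<le> (2 * norm \<alpha>) powr a"
    using \<alpha>0 pos by (simp add: field_simps)
  then have "(norm (f 0) powr a * norm (g 0) powr b / C) powr (1 / a) \<le> ((2 * norm \<alpha>) powr a) powr (1 / a)"
    using pos by (intro powr_mono2) auto
  also have "\<dots> = 2 * norm \<alpha>" using pos \<alpha>0 by (simp add: powr_powr)
  finally show ?thesis .
qed

text \<open>On a disc free of zeros of \<open>f\<close> and \<open>g\<close> there is a branch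
  \<open>E\<close> of f^a g^b, bounded by \<open>C\<close>. Cauchy's inequality bounds its
  derivative at 0, and dividing by \<open>E 0\<close>, whose modulus is fixed by \<open>x\<close>
  and \<open>y\<close>, gives the claim. The radius depends only on \<open>a\<close>,
  \<open>b\<close>, \<open>C\<close>, \<open>x\<close> and \<open>y\<close>, so \<open>M\<close> is
  uniform in \<open>f\<close> and \<open>g\<close>.\<close>

lemma logarithmic_derivative_bound:
  fixes x y :: complex
  assumes pos: "0 < a" "0 < b" "0 < C" and nz: "x \<noteq> 0" "y \<noteq> 0"
  shows "\<exists>M. \<forall>f g. f holomorphic_on ball 0 1 \<longrightarrow> g holomorphic_on ball 0 1 \<longrightarrow> f 0 = x \<longrightarrow> g 0 = y \<longrightarrow>
    (\<forall>z\<in>ball 0 1. norm (f z) powr a * norm (g z) powr b \<le> C) \<longrightarrow>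
    norm (of_real a * deriv f 0 / x + of_real b * deriv g 0 / y) \<le> M"
proof -
  define E0 where "E0 = norm x powr a * norm y powr b"
  define \<kappa> where "\<kappa> = E0 / C"
  \<comment> \<open>By \<open>zero_far_from_origin\<close>, a zero of \<open>f\<close> or
    \<open>g\<close> within 1/2 of the origin has modulus at least half of \<kappa>^(1/a) or
    \<kappa>^(1/b), respectively.\<close>
  define \<rho> where "\<rho> = min 1 (min (\<kappa> powr (1 / a)) (\<kappa> powr (1 / b))) / 2"
  have E0: "E0 > 0" using nz by (simp add: E0_def)
  have "\<kappa> > 0" using E0 pos by (simp add: \<kappa>_def)
  then have \<rho>: "\<rho> > 0" "\<rho> \<le> 1/2" "2 * \<rho> \<le> \<kappa> powr (1 / a)" "2 * \<rho> \<le> \<kappa> powr (1 / b)"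
    unfolding \<rho>_def by auto
  show ?thesis
  proof (intro exI allI impI)
    fix f g :: "complex \<Rightarrow> complex"
    assume hol: "f holomorphic_on ball 0 1" "g holomorphic_on ball 0 1" and fg: "f 0 = x" "g 0 = y"
      and le: "\<forall>z\<in>ball 0 1. norm (f z) powr a * norm (g z) powr b \<le> C"
    have sub: "ball 0 \<rho> \<subseteq> ball (0::complex) 1" using \<rho> by auto
    have "f z \<noteq> 0" if "z \<in> ball 0 \<rho>" for z
    proof
      assume "f z = 0"
      have "\<kappa> powr (1 / a) \<le> 2 * norm z" unfolding \<kappa>_def E0_def fg[symmetric]
        by (rule zero_far_from_origin[OF hol pos]) (use le nz fg \<open>f z = 0\<close> that \<rho> in auto)
      with that \<rho> show False by simp
    qed
    then obtain F where F: "F holomorphic_on ball 0 \<rho>" "\<And>z. z \<in> ball 0 \<rho> \<Longrightarrow> exp (F z) = f z"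
      using holomorphic_logarithm_exists[of "ball 0 \<rho>" f 0] holomorphic_on_subset[OF hol(1) sub] \<rho>(1)
      by (metis convex_ball open_ball centre_in_ball)
    have "g z \<noteq> 0" if "z \<in> ball 0 \<rho>" for z
    proof
      assume "g z = 0"
      have "\<kappa> powr (1 / b) \<le> 2 * norm z"
        unfolding \<kappa>_def E0_def fg[symmetric] mult.commute[of "norm (f 0) powr a"]
        by (rule zero_far_from_origin[OF hol(2,1) pos(2,1,3)])
          (use le nz fg \<open>g z = 0\<close> that \<rho> in \<open>auto simp: mult.commute\<close>)
      with that \<rho> show False by simp
    qed
    then obtain H where H: "H holomorphic_on ball 0 \<rho>" "\<And>z. z \<in> ball 0 \<rho> \<Longrightarrow> exp (H z) = g z"
      using holomorphic_logarithm_exists[of "ball 0 \<rho>" g 0] holomorphic_on_subset[OF hol(2) sub] \<rho>(1)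
      by (metis convex_ball open_ball centre_in_ball)
    define E where "E = (\<lambda>z. exp (of_real a * F z + of_real b * H z))"
    have holE: "E holomorphic_on ball 0 \<rho>" unfolding E_def
      by (intro holomorphic_intros F H)
    have normE: "norm (E z) = norm (f z) powr a * norm (g z) powr b" if "z \<in> ball 0 \<rho>" for z
      unfolding E_def F(2)[OF that, symmetric] H(2)[OF that, symmetric]
      by (simp add: norm_exp_eq_Re norm_mult exp_add exp_powr_real mult.commute)
    have "norm ((deriv ^^ 1) E 0) \<le> fact 1 * C / (\<rho>/2) ^ 1"
    proof (rule Cauchy_inequality)
      show "E holomorphic_on ball 0 (\<rho>/2)" "continuous_on (cball 0 (\<rho>/2)) E"
        using holE \<rho> by (auto intro!: holomorphic_on_imp_continuous_on elim!: holomorphic_on_subset)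
      show "norm (E z) \<le> C" if "norm (0 - z) = \<rho>/2" for z
        using normE[of z] le \<rho> that by auto
    qed (use \<rho> in auto)
    then have dE: "norm (deriv E 0) \<le> 2 * C / \<rho>" by (simp add: mult.commute)
    have z0: "0 \<in> ball (0::complex) \<rho>" using \<rho> by simp
    have log_deriv: "deriv u 0 = deriv U 0 * u 0"
      if U: "U holomorphic_on ball 0 \<rho>" "\<And>z. z \<in> ball 0 \<rho> \<Longrightarrow> exp (U z) = u z" for u U :: "complex \<Rightarrow> complex"
    proof -
      have "((\<lambda>z. exp (U z)) has_field_derivative exp (U 0) * deriv U 0) (at 0)"
        by (rule DERIV_chain2[OF DERIV_exp holomorphic_derivI[OF U(1) open_ball z0]])
      then have "(u has_field_derivative exp (U 0) * deriv U 0) (at 0)"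
        by (rule has_field_derivative_transform_within_open[OF _ open_ball z0]) (use U in auto)
      then show ?thesis using U(2)[OF z0] by (simp add: DERIV_imp_deriv mult.commute)
    qed
    have "((\<lambda>z. of_real a * F z + of_real b * H z) has_field_derivative
        of_real a * deriv F 0 + of_real b * deriv H 0) (at 0)"
      using F H z0 by (auto intro!: derivative_eq_intros holomorphic_derivI)
    then have "deriv (\<lambda>z. of_real a * F z + of_real b * H z) 0 = of_real a * deriv F 0 + of_real b * deriv H 0"
      by (rule DERIV_imp_deriv)
    moreover have "deriv E 0 = deriv (\<lambda>z. of_real a * F z + of_real b * H z) 0 * E 0"
      by (rule log_deriv) (auto simp: E_def intro!: holomorphic_intros F H)
    moreover have "deriv F 0 = deriv f 0 / x" "deriv H 0 = deriv g 0 / y"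
      using log_deriv[of F f] log_deriv[of H g] F H fg nz by simp_all
    ultimately have "deriv E 0 = (of_real a * deriv f 0 / x + of_real b * deriv g 0 / y) * E 0"
      by simp
    then have "norm (of_real a * deriv f 0 / x + of_real b * deriv g 0 / y) * E0 \<le> 2 * C / \<rho>"
      using dE normE[OF z0] fg by (simp add: norm_mult E0_def)
    then show "norm (of_real a * deriv f 0 / x + of_real b * deriv g 0 / y) \<le> 2 * C / \<rho> / E0"
      by (subst pos_le_divide_eq[OF E0])
  qed
qed

theorem reinhardt_ball_exhaustible_kobayashi_zero:
  assumes "ball_exhaustible G" "reinhardt G" "domain2 G"
    and zero: "\<And>p v. p \<in> G \<Longrightarrow> kobayashi_metric G p v = 0"
  shows "G = UNIV"
proof (rule ccontr)
  assume "G \<noteq> UNIV"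
  have G: "ball_exhaustible G" "reinhardt G" "open G" "connected G" "G \<noteq> {}"
    using assms by (auto simp: domain2_def)
  note dom = log_image_dominates[OF G(1-4)]
  obtain a b d where ab: "a \<ge> 0" "b \<ge> 0" "a + b > 0"
    "\<And>s t. (s, t) \<in> log_image G \<Longrightarrow> a * s + b * t \<le> d"
    using log_image_half_plane[OF G(1-4) \<open>G \<noteq> UNIV\<close> G(5)] by metis
  obtain s t where st: "(s, t) \<in> log_image G" using dom G(5) by (metis ex_in_conv prod.collapse)
  define x y :: complex where "x = of_real (exp s)" "y = of_real (exp t)"
  have xy: "(x, y) \<in> G" "x \<noteq> 0" "y \<noteq> 0" using st by (auto simp: log_image_def x_y_def)
  have pw: "r powr c \<le> exp (c * s)" if "0 \<le> r" "r \<le> exp s" "0 \<le> c" for r c s :: real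
    using powr_mono2[OF that(3,1,2)] by (simp add: exp_powr_real mult.commute)
  \<comment> \<open>The test direction is the base point \<open>(x, y)\<close> itself: a disc
    tangent to it has both logarithmic derivatives at 0 equal to 1 / \<alpha>, so the bounded
    quantity is (a' + b') / \<alpha>, while \<alpha> can be made arbitrarily small.\<close>
  have no: False if e: "e > 0" and c: "a' + b' > 0" and disc: "\<And>f g. f holomorphic_on ball 0 1 \<Longrightarrow>
    g holomorphic_on ball 0 1 \<Longrightarrow> f 0 = x \<Longrightarrow> g 0 = y \<Longrightarrow> (\<And>z. z \<in> ball 0 1 \<Longrightarrow> (f z, g z) \<in> G) \<Longrightarrow>
    norm (of_real a' * deriv f 0 / x + of_real b' * deriv g 0 / y) \<le> e" for a' b' e
  proof -
    have "kobayashi_metric G (x, y) (x, y) = 0" using zero xy by simp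
    moreover have "0 < (a' + b') / e" using e c by simp
    ultimately obtain \<alpha> \<phi> where \<alpha>: "0 < \<alpha>" "\<alpha> < (a' + b') / e"
      "(\<lambda>z. fst (\<phi> z)) holomorphic_on ball 0 1" "(\<lambda>z. snd (\<phi> z)) holomorphic_on ball 0 1"
      "\<phi> ` ball 0 1 \<subseteq> G" "\<phi> 0 = (x, y)"
      "cscale (of_real \<alpha>) (deriv (\<lambda>z. fst (\<phi> z)) 0, deriv (\<lambda>z. snd (\<phi> z)) 0) = (x, y)"
      unfolding kobayashi_metric_eq_0_iff by metis
    let ?f' = "deriv (\<lambda>z. fst (\<phi> z)) 0" and ?g' = "deriv (\<lambda>z. snd (\<phi> z)) 0"
    have "norm (of_real a' * ?f' / x + of_real b' * ?g' / y) \<le> e"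
      by (rule disc) (use \<alpha> in auto)
    moreover have "of_real \<alpha> * ?f' = x" "of_real \<alpha> * ?g' = y" using \<alpha>(7) by (auto simp: cscale_def)
    then have "?f' / x = 1 / of_real \<alpha>" "?g' / y = 1 / of_real \<alpha>" using xy \<alpha>(1) by (auto simp: field_simps)
    then have "of_real a' * ?f' / x + of_real b' * ?g' / y = of_real ((a' + b') / \<alpha>)"
      unfolding times_divide_eq_right[symmetric] by (simp add: add_divide_distrib)
    ultimately have "(a' + b') / \<alpha> \<le> e" using c \<alpha>(1) by (simp only: norm_of_real)
    then show False using \<alpha> e by (simp add: field_simps)
  qed
  \<comment> \<open>If one exponent is zero, the constant function 1 with exponent 1 stands in for
    that coordinate, so the estimate for two positive exponents applies. Below,
    \<open>max M 1\<close> makes the bound positive.\<close>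
  have uno: "(\<lambda>_. 1) holomorphic_on ball (0::complex) 1" by simp
  consider "a = 0" "b > 0" | "a > 0" "b = 0" | "a > 0" "b > 0" using ab by linarith
  then show False
  proof cases
    case 1
    obtain M where M: "\<forall>f g. f holomorphic_on ball 0 1 \<longrightarrow> g holomorphic_on ball 0 1 \<longrightarrow> f 0 = 1 \<longrightarrow> g 0 = y \<longrightarrow>
      (\<forall>z\<in>ball 0 1. norm (f z) powr 1 * norm (g z) powr b \<le> exp d) \<longrightarrow>
      norm (of_real 1 * deriv f 0 / 1 + of_real b * deriv g 0 / y) \<le> M"
      using logarithmic_derivative_bound[of 1 b "exp d" 1 y] 1 xy by auto
    show ?thesis
    proof (rule no[of "max M 1" 0 b])
      fix f g assume fg: "f holomorphic_on ball 0 1" "g holomorphic_on ball 0 1" "f 0 = x" "g 0 = y"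
        "\<And>z. z \<in> ball 0 1 \<Longrightarrow> (f z, g z) \<in> G"
      have "norm (g z) powr b \<le> exp d" if z: "z \<in> ball 0 1" for z
      proof -
        obtain s t where *: "(s, t) \<in> log_image G" "norm (g z) \<le> exp t"
          using dom[OF fg(5)[OF z]] by metis
        then show ?thesis using pw[of "norm (g z)" t b] ab(4)[OF *(1)] 1
          by simp (meson dual_order.trans exp_le_cancel_iff)
      qed
      then show "norm (of_real 0 * deriv f 0 / x + of_real b * deriv g 0 / y) \<le> max M 1"
        using M[rule_format, OF uno fg(2) _ fg(4)] by fastforce
    qed (use 1 in auto)
  next
    case 2
    obtain M where M: "\<forall>f g. f holomorphic_on ball 0 1 \<longrightarrow> g holomorphic_on ball 0 1 \<longrightarrow> f 0 = x \<longrightarrow> g 0 = 1 \<longrightarrow>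
      (\<forall>z\<in>ball 0 1. norm (f z) powr a * norm (g z) powr 1 \<le> exp d) \<longrightarrow>
      norm (of_real a * deriv f 0 / x + of_real 1 * deriv g 0 / 1) \<le> M"
      using logarithmic_derivative_bound[of a 1 "exp d" x 1] 2 xy by auto
    show ?thesis
    proof (rule no[of "max M 1" a 0])
      fix f g assume fg: "f holomorphic_on ball 0 1" "g holomorphic_on ball 0 1" "f 0 = x" "g 0 = y"
        "\<And>z. z \<in> ball 0 1 \<Longrightarrow> (f z, g z) \<in> G"
      have "norm (f z) powr a \<le> exp d" if z: "z \<in> ball 0 1" for z
      proof -
        obtain s t where *: "(s, t) \<in> log_image G" "norm (f z) \<le> exp s"
          using dom[OF fg(5)[OF z]] by metis
        then show ?thesis using pw[of "norm (f z)" s a] ab(4)[OF *(1)] 2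
          by simp (meson dual_order.trans exp_le_cancel_iff)
      qed
      then show "norm (of_real a * deriv f 0 / x + of_real 0 * deriv g 0 / y) \<le> max M 1"
        using M[rule_format, OF fg(1) uno fg(3)] by fastforce
    qed (use 2 in auto)
  next
    case 3
    obtain M where M: "\<forall>f g. f holomorphic_on ball 0 1 \<longrightarrow> g holomorphic_on ball 0 1 \<longrightarrow> f 0 = x \<longrightarrow> g 0 = y \<longrightarrow>
      (\<forall>z\<in>ball 0 1. norm (f z) powr a * norm (g z) powr b \<le> exp d) \<longrightarrow>
      norm (of_real a * deriv f 0 / x + of_real b * deriv g 0 / y) \<le> M"
      using logarithmic_derivative_bound[of a b "exp d" x y] 3 xy by auto
    show ?thesis
    proof (rule no[of "max M 1" a b])
      fix f g assume fg: "f holomorphic_on ball 0 1" "g holomorphic_on ball 0 1" "f 0 = x" "g 0 = y"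
        "\<And>z. z \<in> ball 0 1 \<Longrightarrow> (f z, g z) \<in> G"
      have "norm (f z) powr a * norm (g z) powr b \<le> exp d" if z: "z \<in> ball 0 1" for z
      proof -
        obtain s t where *: "(s, t) \<in> log_image G" "norm (f z) \<le> exp s" "norm (g z) \<le> exp t"
          using dom[OF fg(5)[OF z]] by metis
        have "norm (f z) powr a * norm (g z) powr b \<le> exp (a * s) * exp (b * t)"
          using * 3 by (intro mult_mono pw) auto
        also have "\<dots> \<le> exp d" using ab(4)[OF *(1)] by (simp flip: exp_add)
        finally show ?thesis .
      qed
      then show "norm (of_real a * deriv f 0 / x + of_real b * deriv g 0 / y) \<le> max M 1"
        using M[rule_format, OF fg(1,2,3,4)] by fastforce
    qed (use 3 in auto)
  qed
qed

section \<open>Mean values on circles\<close>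

text \<open>For a continuous function both extended integrals are finite, so their difference is the
  ordinary integral.\<close>

lemma circle_mean_continuous:
  assumes "continuous_on {0..2*pi} h"
  shows "circle_mean (\<lambda>\<theta>. ereal (h \<theta>)) = ereal (integral {0..2*pi} h / (2*pi))"
proof -
  let ?h = "\<lambda>\<theta>. indicat_real {0..2*pi} \<theta> *\<^sub>R h \<theta>"
  have si: "set_integrable lborel {0..2*pi} h"
    using assms by (rule borel_integrable_atLeastAtMost')
  then have int: "integrable lborel ?h" by (simp add: set_integrable_def)
  have e: "(\<integral>\<^sup>+\<theta>\<in>{0..2*pi}. e2ennreal (ereal (k \<theta>)) \<partial>lborel)
      = (\<integral>\<^sup>+\<theta>. ennreal (indicat_real {0..2*pi} \<theta> *\<^sub>R k \<theta>) \<partial>lborel)" for k :: "real \<Rightarrow> real"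
    by (intro nn_integral_cong) (auto simp: indicator_def e2ennreal_ereal)
  let ?P = "\<integral>\<^sup>+\<theta>. ennreal (?h \<theta>) \<partial>lborel" and ?N = "\<integral>\<^sup>+\<theta>. ennreal (- ?h \<theta>) \<partial>lborel"
  have fin: "?P < top" "?N < top"
    using int by (auto simp: real_integrable_def less_top)
  have r: "enn2ereal c = ereal (enn2real c)" if "c < top" for c
    using that by (cases c) auto
  have "integral {0..2*pi} h = integral\<^sup>L lborel ?h"
    using set_borel_integral_eq_integral(2)[OF si] by (simp add: set_lebesgue_integral_def)
  also have "\<dots> = enn2real ?P - enn2real ?N"
    by (rule real_lebesgue_integral_def[OF int])
  finally have "ereal (integral {0..2*pi} h) = enn2ereal ?P - enn2ereal ?N"
    using fin by (simp add: r)
  moreover have "circle_mean (\<lambda>\<theta>. ereal (h \<theta>)) = (enn2ereal ?P - enn2ereal ?N) / ereal (2 * pi)"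
    using e[of h] e[of "\<lambda>\<theta>. - h \<theta>"] by (simp add: circle_mean_def)
  ultimately have "circle_mean (\<lambda>\<theta>. ereal (h \<theta>)) = ereal (integral {0..2*pi} h) / ereal (2 * pi)"
    by (simp only:)
  then show ?thesis by simp
qed

lemma integral_period_shift:
  fixes g :: "real \<Rightarrow> real"
  assumes cont: "continuous_on UNIV g" and per: "\<And>x. g (x + p) = g x" and t: "0 \<le> t" "t \<le> p"
  shows "integral {t..t + p} g = integral {0..p} g"
proof -
  have i: "g integrable_on {x..y}" for x y
    by (intro integrable_continuous_real continuous_on_subset[OF cont]) auto
  have "integral {p..t + p} g = integral {0..t} (\<lambda>x. g (x + p))"
    using has_integral_shift_real_ivl[OF integrable_integral[OF i[of p "t + p"]], of p]
    by (simp add: integral_unique)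
  then have "integral {p..t + p} g = integral {0..t} g" by (simp add: per)
  moreover have "integral {0..t} g + integral {t..p} g = integral {0..p} g"
    by (rule Henstock_Kurzweil_Integration.integral_combine) (use t i in auto)
  moreover have "integral {t..p} g + integral {p..t + p} g = integral {t..t + p} g"
    by (rule Henstock_Kurzweil_Integration.integral_combine) (use t i in auto)
  ultimately show ?thesis by simp
qed

text \<open>Left-endpoint sums with an explicit error. The starting point \<open>t\<close> is left
  free because the rotation used in \<open>submean_ln_max\<close> changes with the number of
  nodes.\<close>

lemma riemann_sum_le_integral:
  fixes g :: "real \<Rightarrow> real"
  assumes cont: "continuous_on UNIV g" and "0 \<le> h"
    and close: "\<And>x y. t \<le> x \<Longrightarrow> x \<le> y \<Longrightarrow> y \<le> t + real N * h \<Longrightarrow> y \<le> x + h \<Longrightarrow> g x \<le> g y + e"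
  shows "k \<le> N \<Longrightarrow> h * (\<Sum>j<k. g (t + real j * h)) \<le> integral {t..t + real k * h} g + real k * h * e"
proof (induction k)
  case (Suc k)
  have i: "g integrable_on {x..y}" for x y
    by (intro integrable_continuous_real continuous_on_subset[OF cont]) auto
  let ?x = "t + real k * h" and ?y = "t + real (Suc k) * h"
  have y: "?y = ?x + h" by (simp add: algebra_simps)
  have top: "?y \<le> t + real N * h" using Suc.prems \<open>0 \<le> h\<close> by (intro add_left_mono mult_right_mono) auto
  have "integral {?x..?y} (\<lambda>_. g ?x - e) \<le> integral {?x..?y} g"
  proof (rule integral_le)
    fix z assume "z \<in> {?x..?y}"
    then have "g ?x \<le> g z + e"
      using top \<open>0 \<le> h\<close> unfolding y by (intro close) auto
    then show "g ?x - e \<le> g z" by simp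
  qed (use i in auto)
  then have "h * (g ?x - e) \<le> integral {?x..?y} g"
    using \<open>0 \<le> h\<close> unfolding y by simp
  moreover have "integral {t..?x} g + integral {?x..?y} g = integral {t..?y} g"
    using \<open>0 \<le> h\<close> Henstock_Kurzweil_Integration.integral_combine[where a = t and c = ?x and b = ?y and f = g] i[of t ?y] unfolding y by simp
  ultimately show ?case using Suc by (simp add: algebra_simps)
qed simp

text \<open>Jensen's inequality without zeros or logarithms: for the \<open>N\<close>-th roots of unity \<open>\<omega>\<^sub>k\<close> the
  maximum principle for \<open>\<Prod>k. f (\<omega>\<^sub>k z)\<close> bounds \<open>\<bar>f 0\<bar> ^ N\<close> by a product over a rotated
  set of roots, and the resulting Riemann sums converge uniformly in the rotation.\<close>

lemma submean_ln_max:
  fixes f :: "complex \<Rightarrow> complex"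
  assumes hol: "f holomorphic_on UNIV" and s: "0 < s"
  shows "2 * pi * ln (max (norm (f 0)) s) \<le> integral {0..2*pi} (\<lambda>\<theta>. ln (max (norm (f (exp (\<i> * of_real \<theta>)))) s))"
proof -
  define g where "g = (\<lambda>\<theta>::real. ln (max (norm (f (exp (\<i> * of_real \<theta>)))) s))"
  have cf: "continuous_on A (\<lambda>x. f (k x))" if "continuous_on A k" for A :: "'b::topological_space set" and k
    using continuous_on_compose2[OF holomorphic_on_imp_continuous_on[OF hol] that] by auto
  have cont: "continuous_on UNIV g"
    unfolding g_def using s by (intro continuous_intros cf) auto
  have per: "g (x + 2 * pi) = g x" for x
  proof -
    have "exp (\<i> * of_real (x + 2 * pi)) = exp (\<i> * of_real x) * exp (2 * of_real pi * \<i>)"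
      unfolding exp_add[symmetric] by (simp add: algebra_simps)
    then show ?thesis by (simp add: g_def exp_two_pi_i)
  qed
  have i: "g integrable_on {x..y}" for x y
    by (intro integrable_continuous_real continuous_on_subset[OF cont]) auto
  have gge: "ln s \<le> g x" for x using s by (simp add: g_def)
  have "2 * pi * ln (max (norm (f 0)) s) \<le> integral {0..2*pi} g"
  proof (cases "norm (f 0) \<le> s")
    case True
    have "integral {0..2*pi} (\<lambda>_. ln s) \<le> integral {0..2*pi} g"
      by (rule integral_le) (use i gge in auto)
    with True show ?thesis by (simp add: max_def)
  next
    case False
    then have f0: "0 < norm (f 0)" using s by linarith
    have "2 * pi * ln (norm (f 0)) \<le> integral {0..2*pi} g"
    proof (rule field_le_epsilon)
      fix e :: real assume "0 < e"
      \<comment> \<open>The sample points run through one full turn starting at an angle below 2 pi,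
        hence up to 4 pi.\<close>
      have "uniformly_continuous_on {0..4*pi} g"
        by (intro compact_uniformly_continuous continuous_on_subset[OF cont]) auto
      then obtain d where d: "d > 0"
        "\<And>x y. x \<in> {0..4*pi} \<Longrightarrow> y \<in> {0..4*pi} \<Longrightarrow> \<bar>y - x\<bar> < d \<Longrightarrow> \<bar>g y - g x\<bar> < e / (2 * pi)"
        using \<open>0 < e\<close> unfolding uniformly_continuous_on_def dist_real_def
        by (metis divide_pos_pos mult_pos_pos pi_gt_zero zero_less_numeral)
      obtain n :: nat where n: "2 * pi / d < real n" using reals_Archimedean2 by blast
      define N where "N = Suc n"
      define h where "h = 2 * pi / real N"
      have "2 * pi < real N * d" using n d(1) by (simp add: N_def divide_less_eq algebra_simps)
      then have h: "0 \<le> h" "h < d" "real N * h = 2 * pi"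
        by (auto simp: h_def N_def divide_less_eq mult.commute)
      define P where "P = (\<lambda>z. \<Prod>j<N. f (exp (\<i> * of_real (real j * h)) * z))"
      have holP: "P holomorphic_on A" for A
        unfolding P_def
        by (intro holomorphic_intros holomorphic_on_compose_gen[OF _ hol, unfolded o_def]) auto
      \<comment> \<open>The maximum principle guarantees |P z| >= |P 0| only at a maximum point on
        the circle, so the rotation cannot be prescribed.\<close>
      obtain z where z: "norm z = 1" "\<And>w. norm w = 1 \<Longrightarrow> norm (P w) \<le> norm (P z)"
      proof -
        have "continuous_on (sphere 0 1) (\<lambda>z. norm (P z))"
          by (intro continuous_intros holomorphic_on_imp_continuous_on holP)
        then show ?thesis
          using continuous_attains_sup[of "sphere 0 1" "\<lambda>z. norm (P z)"] that by fastforce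
      qed
      have "norm (P 0) \<le> norm (P z)"
        by (rule maximum_modulus_frontier[where S = "cball 0 1" and f = P])
          (use z in \<open>auto intro!: holP holomorphic_on_imp_continuous_on\<close>)
      then have le: "norm (f 0) ^ N \<le> norm (P z)" by (simp add: P_def norm_power)
      define t where "t = Arg2pi z"
      have t: "0 \<le> t" "t < 2 * pi" "z = exp (\<i> * of_real t)"
        using Arg2pi[of z] z by (simp_all add: t_def is_Arg_def)
      \<comment> \<open>Replacing |f| by the truncated modulus only enlarges the product, so zeros
        of \<open>f\<close> on the circle are harmless.\<close>
      have fg: "norm (f (exp (\<i> * of_real x))) \<le> exp (g x)" for x
        using s by (simp add: g_def)
      have "norm (P z) \<le> (\<Prod>j<N. exp (g (t + real j * h)))"
        unfolding P_def prod_norm[symmetric]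
      proof (rule prod_mono, safe)
        fix j
        have "exp (\<i> * of_real (real j * h)) * z = exp (\<i> * of_real (t + real j * h))"
          by (simp add: t(3) algebra_simps flip: exp_add)
        then show "norm (f (exp (\<i> * of_real (real j * h)) * z)) \<le> exp (g (t + real j * h))"
          using fg by metis
      qed simp
      also have "\<dots> = exp (\<Sum>j<N. g (t + real j * h))" by (simp add: exp_sum)
      finally have "norm (f 0) ^ N \<le> exp (\<Sum>j<N. g (t + real j * h))" using le by linarith
      then have "ln (norm (f 0) ^ N) \<le> (\<Sum>j<N. g (t + real j * h))"
        using f0 by (metis ln_exp ln_le_cancel_iff exp_gt_zero zero_less_power)
      then have "real N * ln (norm (f 0)) \<le> (\<Sum>j<N. g (t + real j * h))"
        using f0 by (simp add: ln_realpow)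
      then have "h * (real N * ln (norm (f 0))) \<le> h * (\<Sum>j<N. g (t + real j * h))"
        using h(1) by (rule mult_left_mono)
      also have "\<dots> \<le> integral {t..t + real N * h} g + real N * h * (e / (2 * pi))"
      proof (rule riemann_sum_le_integral[OF cont h(1), where N = N])
        fix x y assume "t \<le> x" "x \<le> y" "y \<le> t + real N * h" "y \<le> x + h"
        then have "\<bar>g y - g x\<bar> < e / (2 * pi)" using t h by (intro d(2)) auto
        then show "g x \<le> g y + e / (2 * pi)" by linarith
      qed simp
      also have "\<dots> = integral {0..2*pi} g + e"
        using integral_period_shift[OF cont per] t by (simp add: h(3))
      also have "h * (real N * ln (norm (f 0))) = 2 * pi * ln (norm (f 0))"
        unfolding h(3)[symmetric] by (simp only: mult_ac)
      finally show "2 * pi * ln (norm (f 0)) \<le> integral {0..2*pi} g + e" .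
    qed
    with False show ?thesis by (simp add: max_def)
  qed
  then show ?thesis by (simp add: g_def)
qed

section \<open>The basin of attraction\<close>

lemma norm_pair_le: "norm (x :: complex2) \<le> norm (fst x) + norm (snd x)"
  by (metis norm_Pair_le prod.collapse)

lemma norm_fst_snd_le: "norm (fst (x :: complex2)) \<le> norm x" "norm (snd (x :: complex2)) \<le> norm x"
  by (metis norm_fst_le prod.collapse) (metis norm_snd_le prod.collapse)

lemma norm_cscale: "norm (cscale c v) = norm c * norm v"
proof -
  have "(norm (cscale c v))\<^sup>2 = (norm c * norm v)\<^sup>2"
    by (cases v) (simp add: cscale_def norm_Pair norm_mult power_mult_distrib ring_distribs)
  then show ?thesis by (simp add: power2_eq_iff_nonneg)
qed

lemma cscale_cscale: "cscale a (cscale b v) = cscale (a * b) v" and cscale_1: "cscale 1 v = v"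
  by (simp_all add: cscale_def mult.assoc)

lemma continuous_on_cscale [continuous_intros]:
  assumes "continuous_on A f" "continuous_on A g"
  shows "continuous_on A (\<lambda>x. cscale (f x) (g x))"
  using assms unfolding cscale_def by (intro continuous_intros)

lemma holomorphic2_on_cscale: "holomorphic2_on (cscale c) U"
  unfolding holomorphic2_on_def
proof
  fix p :: complex2
  have "(cscale c has_derivative cscale c) (at p)"
    unfolding cscale_def[abs_def] by (auto intro!: derivative_eq_intros)
  then show "\<exists>D. (cscale c has_derivative D) (at p) \<and> (\<forall>k v. D (cscale k v) = cscale k (D v))"
    by (intro exI[of _ "cscale c"]) (simp add: cscale_cscale mult.commute)
qed

lemma holomorphic2_on_id: "holomorphic2_on (\<lambda>p. p) U"
  unfolding holomorphic2_on_def using has_derivative_ident by blast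

text \<open>Half the cut-off of stage \<open>n + 1\<close>, hence the exponent
  \<open>2 ^ Suc n\<close>: as the second coordinate is at most 1/2 in modulus, the perturbation of
  z^2 stays below a quarter of that cut-off.\<close>

definition henon_coeff :: "nat \<Rightarrow> real" where
  "henon_coeff n = (1/16) ^ (2 ^ Suc n) / 2"

definition henon :: "nat \<Rightarrow> complex2 \<Rightarrow> complex2" where
  "henon n p = ((fst p)\<^sup>2 + of_real (henon_coeff n) * snd p, of_real (henon_coeff n) * fst p)"

definition henon_inv :: "nat \<Rightarrow> complex2 \<Rightarrow> complex2" where
  "henon_inv n q = (inverse (of_real (henon_coeff n)) * snd q,
     inverse (of_real (henon_coeff n)) * (fst q - (inverse (of_real (henon_coeff n)) * snd q)\<^sup>2))"

fun orbit :: "nat \<Rightarrow> complex2 \<Rightarrow> complex2" where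
  "orbit 0 p = p"
| "orbit (Suc n) p = henon n (orbit n p)"

lemma orbit_Suc_comp: "orbit (Suc n) = henon n \<circ> orbit n"
  by auto

fun orbit_inv :: "nat \<Rightarrow> complex2 \<Rightarrow> complex2" where
  "orbit_inv 0 q = q"
| "orbit_inv (Suc n) q = orbit_inv n (henon_inv n q)"

text \<open>On the ball of radius 1/2 every \<open>henon n\<close> contracts norms by the factor
  3/4, so an orbit that has entered this ball never leaves it and the stages increase.\<close>

definition basin_stage :: "nat \<Rightarrow> complex2 set" where
  "basin_stage n = {p. norm (orbit n p) < 1/2}"

definition basin :: "complex2 set" where
  "basin = (\<Union>n. basin_stage n)"

section \<open>Invertibility, holomorphy and contraction of the Henon maps\<close>

lemma henon_coeff_pos: "henon_coeff n > 0"
  by (simp add: henon_coeff_def)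

lemma henon_coeff_le: "henon_coeff n \<le> 1/512"
proof -
  have "(1/16 :: real) ^ (2 ^ Suc n) \<le> (1/16) ^ 2"
    by (intro power_decreasing) auto
  then show ?thesis by (simp add: henon_coeff_def power2_eq_square)
qed

lemma henon_inv_henon [simp]: "henon_inv n (henon n p) = p" "henon n (henon_inv n p) = p"
proof -
  let ?c = "complex_of_real (henon_coeff n)"
  have "?c \<noteq> 0" using henon_coeff_pos[of n] by simp
  then show "henon_inv n (henon n p) = p" "henon n (henon_inv n p) = p"
    by (simp_all add: henon_def henon_inv_def prod_eq_iff flip: mult.assoc)
qed

lemma orbit_inv_orbit [simp]: "orbit_inv n (orbit n p) = p" "orbit n (orbit_inv n p) = p"
  by (induction n arbitrary: p) auto

lemma has_derivative_henon:
  "(henon n has_derivative (\<lambda>v. (2 * fst p * fst v + of_real (henon_coeff n) * snd v,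
      of_real (henon_coeff n) * fst v))) (at p)"
  unfolding henon_def[abs_def] by (auto intro!: derivative_eq_intros simp: algebra_simps)

lemma holomorphic2_on_henon: "holomorphic2_on (henon n) U"
  unfolding holomorphic2_on_def
  using has_derivative_henon[of n] by (fastforce simp: cscale_def algebra_simps)

lemma holomorphic2_on_henon_inv: "holomorphic2_on (henon_inv n) U"
  unfolding holomorphic2_on_def
proof
  fix p :: complex2
  let ?c = "inverse (complex_of_real (henon_coeff n))"
  let ?D = "\<lambda>v. (?c * snd v, ?c * (fst v - 2 * (?c * snd p) * (?c * snd v)))"
  have "(henon_inv n has_derivative ?D) (at p)"
    unfolding henon_inv_def[abs_def]
    by (auto intro!: derivative_eq_intros simp: algebra_simps power2_eq_square)
  then show "\<exists>D. (henon_inv n has_derivative D) (at p) \<and> (\<forall>c v. D (cscale c v) = cscale c (D v))"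
    by (intro exI[of _ ?D]) (simp add: cscale_def algebra_simps)
qed

lemma holomorphic2_on_orbit: "holomorphic2_on (orbit n) UNIV"
proof (induction n)
  case (Suc n)
  from holomorphic2_on_compose[OF this holomorphic2_on_henon[of n UNIV]]
  show ?case by (simp add: o_def)
qed (simp add: holomorphic2_on_id)

lemma holomorphic2_on_orbit_inv: "holomorphic2_on (orbit_inv n) UNIV"
proof (induction n)
  case (Suc n)
  from holomorphic2_on_compose[OF holomorphic2_on_henon_inv[of n UNIV] this]
  show ?case by (simp add: o_def)
qed (simp add: holomorphic2_on_id)

lemma continuous_on_orbit: "continuous_on A (orbit n)"
  using holomorphic2_on_imp_continuous_on[OF holomorphic2_on_orbit] continuous_on_subset by blast

lemma norm_henon_le: "norm (henon n p) \<le> norm p * (norm p + 2 * henon_coeff n)"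
proof -
  have "norm (henon n p) \<le> norm ((fst p)\<^sup>2 + of_real (henon_coeff n) * snd p)
      + norm (of_real (henon_coeff n) * fst p)"
    using norm_pair_le[of "henon n p"] by (simp add: henon_def)
  also have "\<dots> \<le> (norm (fst p))\<^sup>2 + henon_coeff n * norm (snd p) + henon_coeff n * norm (fst p)"
    using norm_triangle_ineq[of "(fst p)\<^sup>2" "of_real (henon_coeff n) * snd p"] henon_coeff_pos[of n]
    by (simp add: norm_mult norm_power)
  also have "\<dots> \<le> (norm p)\<^sup>2 + henon_coeff n * norm p + henon_coeff n * norm p"
    using henon_coeff_pos[of n]
    by (intro add_mono power_mono mult_left_mono norm_fst_snd_le) auto
  finally show ?thesis by (simp add: algebra_simps power2_eq_square)
qed

lemma norm_henon_contract:
  assumes "norm p < 1/2"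
  shows "norm (henon n p) \<le> 3/4 * norm p"
proof -
  have "norm p + 2 * henon_coeff n \<le> 3/4" using assms henon_coeff_le[of n] by linarith
  then have "norm p * (norm p + 2 * henon_coeff n) \<le> norm p * (3/4)"
    by (intro mult_left_mono) auto
  then show ?thesis using norm_henon_le[of n p] by linarith
qed

lemma norm_orbit_add_le:
  assumes "p \<in> basin_stage n"
  shows "norm (orbit (n + k) p) \<le> (3/4) ^ k * norm (orbit n p)"
proof (induction k)
  case (Suc k)
  have "(3/4 :: real) ^ k * norm (orbit n p) \<le> 1 * norm (orbit n p)"
    by (intro mult_right_mono power_le_one) auto
  then have "norm (orbit (n + k) p) < 1/2"
    using Suc assms by (simp add: basin_stage_def)
  from norm_henon_contract[OF this, of "n + k"] Suc show ?case by simp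
qed simp

lemma incseq_basin_stage: "incseq basin_stage"
proof (rule incseq_SucI, rule subsetI)
  fix n p assume p: "p \<in> basin_stage n"
  have "norm (orbit (Suc n) p) \<le> 3/4 * norm (orbit n p)" using norm_orbit_add_le[OF p, of 1] by simp
  then show "p \<in> basin_stage (Suc n)" using p by (simp add: basin_stage_def)
qed

lemma basin_stage_mono: "p \<in> basin_stage n \<Longrightarrow> n \<le> m \<Longrightarrow> p \<in> basin_stage m"
  using incseq_basin_stage by (auto simp: incseq_def)

lemma open_basin_stage: "open (basin_stage n)"
  unfolding basin_stage_def
  by (intro open_Collect_less continuous_intros continuous_on_orbit)

lemma open_basin: "open basin"
  unfolding basin_def using open_basin_stage by blast

text \<open>\<open>orbit n\<close> is an automorphism of C^2, so the stage is a biholomorphic copy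
  of the ball of radius 1/2; the scalings adjust the radius to 1.\<close>

lemma biholomorphic2_basin_stage: "biholomorphic2 (ball 0 1) (basin_stage n)"
proof -
  let ?f = "orbit_inv n \<circ> cscale (1/2)" and ?g = "cscale 2 \<circ> orbit n"
  have "biholomorphic_map ?f (ball 0 1) (basin_stage n)"
  proof (rule biholomorphic_mapI[where g = ?g, OF open_ball open_basin_stage])
    show "holomorphic2_on ?f (ball 0 1)"
      by (rule holomorphic2_on_compose[OF holomorphic2_on_cscale holomorphic2_on_orbit_inv]) simp
    show "holomorphic2_on ?g (basin_stage n)"
      by (rule holomorphic2_on_compose[OF holomorphic2_on_subset[OF holomorphic2_on_orbit]
            holomorphic2_on_cscale]) auto
  qed (auto simp: basin_stage_def norm_cscale cscale_cscale cscale_1)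
  then show ?thesis by (auto simp: biholomorphic2_def)
qed

lemma ball_exhaustible_basin: "ball_exhaustible basin"
  unfolding ball_exhaustible_def basin_def
  using incseq_basin_stage biholomorphic2_basin_stage by blast

lemma orbit_0 [simp]: "orbit n 0 = 0"
  by (induction n) (auto simp: henon_def zero_prod_def)

lemma domain2_basin: "domain2 basin"
proof -
  have z: "0 \<in> basin_stage n" for n by (simp add: basin_stage_def)
  have "connected (basin_stage n)" for n
  proof -
    have "basin_stage n = orbit_inv n ` ball 0 (1/2)"
      by (force simp: basin_stage_def image_iff intro: bexI[of _ "orbit n _"])
    also have "connected \<dots>"
      by (intro connected_continuous_image continuous_on_subset[OF holomorphic2_on_imp_continuous_on
            [OF holomorphic2_on_orbit_inv]]) auto
    finally show ?thesis .
  qed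
  then have "connected basin" unfolding basin_def
    using z by (intro connected_Union) blast+
  then show ?thesis using open_basin z by (auto simp: domain2_def basin_def)
qed

text \<open>Derivatives along an orbit contract, since \<open>fst (orbit n p)\<close> tends to \<open>0\<close>.\<close>

lemma orbit_derivative_tendsto_0:
  assumes p: "p \<in> basin" and "0 < e"
  obtains n D where "norm (orbit n p) < 1/4" "(orbit n has_derivative D) (at p)"
    "\<forall>c w. D (cscale c w) = cscale c (D w)" "norm (D v) < e"
proof -
  obtain N where N: "p \<in> basin_stage N" using p by (auto simp: basin_def)
  have "(\<lambda>k. (3/4 :: real) ^ k) \<longlonglongrightarrow> 0" by (intro LIMSEQ_power_zero) auto
  then have "(\<lambda>k. (3/4) ^ k * norm (orbit N p)) \<longlonglongrightarrow> 0" by (intro tendsto_mult_left_zero)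
  then have "\<forall>\<^sub>F k in sequentially. (3/4) ^ k * norm (orbit N p) < 1/8"
    by (rule order_tendstoD) simp
  then obtain K where "(3/4) ^ K * norm (orbit N p) < 1/8"
    by (auto simp: eventually_sequentially)
  then have M: "norm (orbit (N + K) p) < 1/8" using norm_orbit_add_le[OF N, of K] by linarith
  define M where "M = N + K"
  have M8: "norm (orbit M p) < 1/8" using M by (simp add: M_def)
  then have MS: "p \<in> basin_stage M" by (simp add: basin_stage_def)
  \<comment> \<open>The bound 1/8 makes the coefficient 2 * z of the derivative at most 1/4; with
    two terms of size 1/512 added, each further step at least halves the derivative.\<close>
  have small: "norm (orbit (M + k) p) < 1/8" for k
  proof -
    have "(3/4 :: real) ^ k * norm (orbit M p) \<le> 1 * norm (orbit M p)"
      by (intro mult_right_mono power_le_one) auto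
    then show ?thesis using norm_orbit_add_le[OF MS, of k] M8 by linarith
  qed
  obtain D0 where D0: "(orbit M has_derivative D0) (at p)" "\<forall>c w. D0 (cscale c w) = cscale c (D0 w)"
    by (rule holomorphic2_onE[OF holomorphic2_on_orbit UNIV_I])
  have ex: "\<exists>D. (orbit (M + k) has_derivative D) (at p) \<and> (\<forall>c w. D (cscale c w) = cscale c (D w)) \<and>
      norm (D v) \<le> (1/2) ^ k * norm (D0 v)" for k
  proof (induction k)
    case 0
    then show ?case using D0 by (intro exI[of _ D0]) auto
  next
    case (Suc k)
    then obtain D where D: "(orbit (M + k) has_derivative D) (at p)" "\<forall>c w. D (cscale c w) = cscale c (D w)"
      "norm (D v) \<le> (1/2) ^ k * norm (D0 v)" by blast
    let ?a = "henon_coeff (M + k)" and ?z = "fst (orbit (M + k) p)"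
    define E where "E = (\<lambda>v. (2 * ?z * fst v + of_real ?a * snd v, of_real ?a * fst v) :: complex2)"
    have "(henon (M + k) \<circ> orbit (M + k) has_derivative E \<circ> D) (at p)"
      unfolding E_def by (rule diff_chain_at[OF D(1) has_derivative_henon])
    then have "(orbit (M + Suc k) has_derivative E \<circ> D) (at p)"
      by (simp only: add_Suc_right orbit_Suc_comp)
    moreover have "\<forall>c w. (E \<circ> D) (cscale c w) = cscale c ((E \<circ> D) w)"
      using D(2) by (simp add: E_def cscale_def algebra_simps)
    moreover have "norm (E w) \<le> 1/2 * norm w" for w
    proof -
      have "norm (E w) \<le> norm (2 * ?z * fst w + of_real ?a * snd w) + norm (of_real ?a * fst w)"
        using norm_pair_le[of "E w"] by (simp add: E_def)
      also have "\<dots> \<le> 2 * norm ?z * norm (fst w) + ?a * norm (snd w) + ?a * norm (fst w)"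
        using norm_triangle_ineq[of "2 * ?z * fst w" "of_real ?a * snd w"] henon_coeff_pos[of "M + k"]
        by (simp add: norm_mult)
      also have "\<dots> \<le> 2 * (1/8) * norm w + 1/512 * norm w + 1/512 * norm w"
        using small[of k] norm_fst_snd_le[of "orbit (M + k) p"] norm_fst_snd_le[of w]
          henon_coeff_pos[of "M + k"] henon_coeff_le[of "M + k"]
        by (intro add_mono mult_mono) auto
      also have "\<dots> \<le> 1/2 * norm w" by simp
      finally show ?thesis .
    qed
    then have "norm ((E \<circ> D) v) \<le> (1/2) ^ Suc k * norm (D0 v)"
      using order_trans[OF _ mult_left_mono[OF D(3), of "1/2"], of "norm ((E \<circ> D) v)"] by simp
    ultimately show ?case by blast
  qed
  have "(\<lambda>k. (1/2 :: real) ^ k) \<longlonglongrightarrow> 0" by (intro LIMSEQ_power_zero) auto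
  then have "(\<lambda>k. (1/2) ^ k * norm (D0 v)) \<longlonglongrightarrow> 0" by (intro tendsto_mult_left_zero)
  then have "\<forall>\<^sub>F k in sequentially. (1/2) ^ k * norm (D0 v) < e"
    using \<open>0 < e\<close> by (rule order_tendstoD)
  then obtain k where k: "(1/2) ^ k * norm (D0 v) < e"
    by (auto simp: eventually_sequentially)
  obtain D where D: "(orbit (M + k) has_derivative D) (at p)" "\<forall>c w. D (cscale c w) = cscale c (D w)"
      "norm (D v) \<le> (1/2) ^ k * norm (D0 v)" using ex[of k] by blast
  show ?thesis
    by (rule that[OF _ D(1,2)]) (use small[of k] D(3) k in linarith)+
qed

text \<open>After enough steps the orbit point and \<open>D v / \<alpha>\<close> both have norm
  below 1/4. The affine disc they define lies in the ball of radius 1/2, and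
  \<open>orbit_inv n\<close> pulls it back to a disc in the basin with derivative
  \<open>v / \<alpha>\<close>.\<close>

lemma kobayashi_metric_basin:
  assumes p: "p \<in> basin"
  shows "kobayashi_metric basin p v = 0"
  unfolding kobayashi_metric_eq_0_iff
proof (intro allI impI)
  fix \<epsilon> :: real assume "0 < \<epsilon>"
  define \<alpha> where "\<alpha> = \<epsilon> / 2"
  have \<alpha>: "0 < \<alpha>" "\<alpha> < \<epsilon>" "0 < \<alpha> / 4" using \<open>0 < \<epsilon>\<close> by (auto simp: \<alpha>_def)
  obtain n D where nD: "norm (orbit n p) < 1/4" "(orbit n has_derivative D) (at p)"
    "\<forall>c w. D (cscale c w) = cscale c (D w)" "norm (D v) < \<alpha> / 4"
    by (rule orbit_derivative_tendsto_0[OF p \<alpha>(3)])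
  obtain E where E: "(orbit_inv n has_derivative E) (at (orbit n p))" "\<forall>c w. E (cscale c w) = cscale c (E w)"
    by (rule holomorphic2_onE[OF holomorphic2_on_orbit_inv UNIV_I])
  have "(orbit_inv n \<circ> orbit n has_derivative E \<circ> D) (at p)"
    by (rule diff_chain_at[OF nD(2) E(1)])
  then have "((\<lambda>p. p) has_derivative E \<circ> D) (at p)" by (simp add: o_def)
  then have "E \<circ> D = (\<lambda>p. p)" using has_derivative_unique has_derivative_ident by blast
  then have ED: "E (D v) = v" by (metis comp_apply)
  define w where "w = cscale (of_real (1 / \<alpha>)) (D v)"
  define \<psi> where "\<psi> = (\<lambda>z. orbit n p + cscale z w)"
  define \<phi> where "\<phi> = (\<lambda>z. orbit_inv n (\<psi> z))"
  have w: "norm w < 1/4" using nD(4) \<alpha> by (simp add: w_def norm_cscale norm_divide field_simps)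
  have \<psi>: "(\<lambda>z. fst (\<psi> z)) holomorphic_on ball 0 1" "(\<lambda>z. snd (\<psi> z)) holomorphic_on ball 0 1"
    unfolding \<psi>_def by (auto intro!: holomorphic_intros)
  note cu = holomorphic2_on_curve[OF holomorphic2_on_orbit_inv[of n] open_ball \<psi> subset_UNIV]
  have \<psi>0: "\<psi> 0 = orbit n p" by (simp add: \<psi>_def cscale_def prod_eq_iff)
  have "deriv (\<lambda>z. fst (\<psi> z)) 0 = fst w" "deriv (\<lambda>z. snd (\<psi> z)) 0 = snd w"
    unfolding \<psi>_def by (auto intro!: DERIV_imp_deriv derivative_eq_intros)
  moreover have "(deriv (\<lambda>z. fst (\<phi> z)) 0, deriv (\<lambda>z. snd (\<phi> z)) 0)
      = E (deriv (\<lambda>z. fst (\<psi> z)) 0, deriv (\<lambda>z. snd (\<psi> z)) 0)"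
    unfolding \<phi>_def by (rule cu(3)) (use E(1) \<psi>0 in auto)
  ultimately have "(deriv (\<lambda>z. fst (\<phi> z)) 0, deriv (\<lambda>z. snd (\<phi> z)) 0) = E w" by simp
  then have der: "cscale (of_real \<alpha>) (deriv (\<lambda>z. fst (\<phi> z)) 0, deriv (\<lambda>z. snd (\<phi> z)) 0) = v"
    using E(2) ED \<alpha> by (simp add: w_def cscale_cscale cscale_1)
  have "\<phi> z \<in> basin" if "z \<in> ball 0 1" for z
  proof -
    have "norm (\<psi> z) \<le> norm (orbit n p) + norm z * norm w"
      unfolding \<psi>_def by (metis norm_cscale norm_triangle_ineq)
    moreover have "norm z * norm w \<le> 1 * norm w" using that by (intro mult_right_mono) auto
    ultimately have "norm (\<psi> z) < 1/2" using w nD(1) by linarith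
    then have "\<phi> z \<in> basin_stage n" by (simp add: basin_stage_def \<phi>_def)
    then show ?thesis by (auto simp: basin_def)
  qed
  moreover have "\<phi> 0 = p" by (simp add: \<phi>_def \<psi>0)
  ultimately show "\<exists>\<alpha> \<phi>. 0 < \<alpha> \<and> \<alpha> < \<epsilon> \<and>
        (\<lambda>z. fst (\<phi> z)) holomorphic_on ball 0 1 \<and> (\<lambda>z. snd (\<phi> z)) holomorphic_on ball 0 1 \<and>
        \<phi> ` ball 0 1 \<subseteq> basin \<and> \<phi> 0 = p \<and>
        cscale (of_real \<alpha>) (deriv (\<lambda>z. fst (\<phi> z)) 0, deriv (\<lambda>z. snd (\<phi> z)) 0) = v"
    using \<alpha> cu(1,2) der unfolding \<phi>_def
    by (intro exI[of _ \<alpha>] exI[of _ "\<lambda>z. orbit_inv n (\<psi> z)"]) auto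
qed

section \<open>The plurisubharmonic potential\<close>

lemma ln_le_iff_le_exp: "0 < x \<Longrightarrow> ln x \<le> y \<longleftrightarrow> x \<le> exp (y :: real)"
  by (metis exp_le_cancel_iff exp_ln)

text \<open>The cut-off squares at each step, as the leading term of the map does, so after division
  by \<open>2 ^ n\<close> it is the same constant ln (1/16) at every level.\<close>

definition potential_approx :: "nat \<Rightarrow> complex2 \<Rightarrow> real" where
  "potential_approx n p = ln (max (norm (fst (orbit n p))) ((1/16) ^ (2 ^ n))) / 2 ^ n"

definition potential :: "complex2 \<Rightarrow> real" where
  "potential p = lim (\<lambda>n. potential_approx n p)"

text \<open>With \<open>s\<close> the cut-off at stage \<open>n\<close>, the next cut-off is s^2 and
  z' differs from z^2 by at most s^2/4. Hence the truncated moduli M' and M^2 agree up to a factor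
  2, whether or not \<open>z\<close> lies below the cut-off.\<close>

lemma potential_approx_step:
  assumes p: "p \<in> basin_stage n"
  shows "\<bar>potential_approx (Suc n) p - potential_approx n p\<bar> \<le> ln 2 / 2 ^ Suc n"
proof -
  define s :: real where "s = (1/16) ^ (2 ^ n)"
  define z where "z = fst (orbit n p)"
  define z' where "z' = fst (orbit (Suc n) p)"
  define M where "M = max (norm z) s"
  define M' where "M' = max (norm z') (s\<^sup>2)"
  have s: "0 < s" by (simp add: s_def)
  have s2: "(1/16) ^ (2 ^ Suc n) = s\<^sup>2"
    by (simp add: s_def power_mult mult.commute flip: power_mult)
  have M: "0 < M" "0 < M'" using s by (auto simp: M_def M'_def less_max_iff_disj)
  have hc: "henon_coeff n = s\<^sup>2 / 2" by (simp only: henon_coeff_def s2)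
  have "norm (snd (orbit n p)) \<le> 1/2"
    using p norm_fst_snd_le(2)[of "orbit n p"] by (simp add: basin_stage_def)
  then have "s\<^sup>2 / 2 * norm (snd (orbit n p)) \<le> s\<^sup>2 / 2 * (1/2)"
    by (intro mult_left_mono) auto
  then have d: "norm (z' - z\<^sup>2) \<le> s\<^sup>2 / 4"
    by (simp add: z'_def z_def henon_def hc norm_mult norm_power norm_divide)
  have up: "M' \<le> 2 * M\<^sup>2"
  proof -
    have "norm z' \<le> norm (z\<^sup>2) + norm (z' - z\<^sup>2)" by (metis add_diff_cancel_left' norm_triangle_sub)
    moreover have "(norm z)\<^sup>2 \<le> M\<^sup>2" "s\<^sup>2 \<le> M\<^sup>2"
      using s by (auto intro!: power_mono simp: M_def)
    ultimately have "norm z' \<le> 2 * M\<^sup>2" "s\<^sup>2 \<le> 2 * M\<^sup>2"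
      using d zero_le_power2[of M] unfolding norm_power by linarith+
    then show ?thesis by (simp add: M'_def)
  qed
  have low: "M\<^sup>2 \<le> 2 * M'"
  proof (cases "norm z \<le> s")
    case True
    then have "M\<^sup>2 = s\<^sup>2" by (simp add: M_def)
    also have "s\<^sup>2 \<le> M'" by (simp add: M'_def)
    finally show ?thesis using M by linarith
  next
    case False
    have "norm (z\<^sup>2) \<le> norm z' + norm (z' - z\<^sup>2)" by (metis norm_minus_commute norm_triangle_sub)
    moreover have "s\<^sup>2 \<le> (norm z)\<^sup>2" using False s by (intro power_mono) auto
    ultimately have "(norm z)\<^sup>2 \<le> 2 * norm z'"
      using d norm_ge_zero[of z'] unfolding norm_power by linarith
    then show ?thesis using False by (auto simp: M_def M'_def)
  qed
  have "ln M' \<le> ln (2 * M\<^sup>2)" using up M by simp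
  moreover have "ln (M\<^sup>2) \<le> ln (2 * M')" using low M by simp
  ultimately have "\<bar>ln M' - 2 * ln M\<bar> \<le> ln 2"
    using M by (simp add: ln_mult ln_realpow)
  moreover have "potential_approx (Suc n) p - potential_approx n p = (ln M' - 2 * ln M) / 2 ^ Suc n"
    unfolding potential_approx_def s2 s_def[symmetric] z_def[symmetric] z'_def[symmetric] M_def M'_def
    by (simp add: field_simps)
  ultimately show ?thesis by (simp add: abs_divide divide_right_mono)
qed

lemma geometric_increments_limit:
  fixes X :: "nat \<Rightarrow> real"
  assumes X: "\<And>n. n \<ge> N \<Longrightarrow> \<bar>X (Suc n) - X n\<bar> \<le> c / 2 ^ Suc n" and n: "n \<ge> N"
  shows "\<bar>lim X - X n\<bar> \<le> c / 2 ^ n"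
proof -
  have c: "c \<ge> 0" using X[OF order_refl] by (simp add: le_divide_eq abs_le_iff) (smt (verit) mult_nonneg_nonneg zero_le_power)
  \<comment> \<open>The exact partial sum of the geometric bounds; the plain bound
    \<open>c / 2 ^ n\<close> would not survive the induction.\<close>
  have d: "\<bar>X (n + k) - X n\<bar> \<le> c / 2 ^ n - c / 2 ^ (n + k)" if "n \<ge> N" for n k
  proof (induction k)
    case (Suc k)
    have "\<bar>X (Suc (n + k)) - X (n + k)\<bar> \<le> c / 2 ^ Suc (n + k)" using X that by simp
    moreover have "c / 2 ^ (n + k) - c / 2 ^ Suc (n + k) = c / 2 ^ Suc (n + k)" by (simp add: field_simps)
    ultimately show ?case using Suc by simp
  qed simp
  have d': "\<bar>X m - X n\<bar> \<le> c / 2 ^ n" if "N \<le> n" "n \<le> m" for n m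
  proof -
    have "0 \<le> c / 2 ^ m" using c by simp
    then show ?thesis using d[OF that(1), of "m - n"] that(2) by simp
  qed
  have "(\<lambda>n. c * (1/2) ^ n) \<longlonglongrightarrow> c * 0" by (intro tendsto_mult_left LIMSEQ_power_zero) auto
  then have lim0: "(\<lambda>n. c / 2 ^ n) \<longlonglongrightarrow> 0" by (simp add: power_divide)
  have "Cauchy X"
  proof (rule CauchyI)
    fix e :: real assume "0 < e"
    then have "\<forall>\<^sub>F n in sequentially. c / 2 ^ n < e / 2" using order_tendstoD(2)[OF lim0, of "e/2"] by simp
    then obtain m where m: "m \<ge> N" "c / 2 ^ m < e / 2"
      unfolding eventually_sequentially by (metis max.cobounded1 max.cobounded2)
    have "norm (X i - X j) < e" if "i \<ge> m" "j \<ge> m" for i j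
      using d'[OF m(1) that(1)] d'[OF m(1) that(2)] m(2) unfolding real_norm_def by linarith
    then show "\<exists>M. \<forall>i\<ge>M. \<forall>j\<ge>M. norm (X i - X j) < e" by blast
  qed
  then have "X \<longlonglongrightarrow> lim X" by (simp add: Cauchy_convergent_iff convergent_LIMSEQ_iff)
  then have "(\<lambda>m. \<bar>X m - X n\<bar>) \<longlonglongrightarrow> \<bar>lim X - X n\<bar>" by (intro tendsto_intros)
  then show ?thesis
    by (rule LIMSEQ_le_const2) (use d' n in blast)
qed

lemma potential_approx_dist:
  assumes "p \<in> basin_stage n"
  shows "\<bar>potential p - potential_approx n p\<bar> \<le> ln 2 / 2 ^ n"
  unfolding potential_def
  by (rule geometric_increments_limit[of n])
    (use assms basin_stage_mono potential_approx_step in blast)+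

lemma ln_power_floor: "ln ((1/16 :: real) ^ (2 ^ n)) = 2 ^ n * ln (1/16)"
  by (simp add: ln_realpow del: power_one_over)

lemma ln_half_pow_tendsto_0: "(\<lambda>n. c * ln 2 / 2 ^ n :: real) \<longlonglongrightarrow> 0"
proof -
  have "(\<lambda>n. c * ln 2 * (1/2 :: real) ^ n) \<longlonglongrightarrow> c * ln 2 * 0"
    by (intro tendsto_mult_left LIMSEQ_power_zero) auto
  then show ?thesis by (simp add: power_divide)
qed

lemma potential_tendsto:
  assumes "p \<in> basin"
  shows "(\<lambda>n. potential_approx n p) \<longlonglongrightarrow> potential p"
proof -
  obtain N where "p \<in> basin_stage N" using assms by (auto simp: basin_def)
  then have "\<forall>\<^sub>F n in sequentially. norm (potential_approx n p - potential p) \<le> ln 2 / 2 ^ n"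
    using potential_approx_dist basin_stage_mono
    by (intro eventually_sequentiallyI[of N]) (simp add: abs_minus_commute)
  then have "(\<lambda>n. potential_approx n p - potential p) \<longlonglongrightarrow> 0"
    by (intro Lim_null_comparison[OF _ ln_half_pow_tendsto_0[of 1]]) simp
  then show ?thesis by (simp add: LIM_zero_iff)
qed

lemma potential_approx_nonpos:
  assumes "p \<in> basin_stage n"
  shows "potential_approx n p \<le> 0"
proof -
  have "norm (fst (orbit n p)) < 1" using assms norm_fst_snd_le(1)[of "orbit n p"]
    by (simp add: basin_stage_def)
  moreover have "(1/16 :: real) ^ (2 ^ n) \<le> 1" by (intro power_le_one) auto
  ultimately show ?thesis
    by (auto simp: potential_approx_def divide_le_0_iff intro!: ln_le_zero_iff[THEN iffD2] simp: less_max_iff_disj)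
qed

lemma potential_nonpos: "p \<in> basin \<Longrightarrow> potential p \<le> 0"
  using potential_approx_nonpos basin_stage_mono
  by (intro LIMSEQ_le_const2[OF potential_tendsto]) (fastforce simp: basin_def)+

lemma potential_approx_ge: "ln (1/16) \<le> potential_approx n p"
proof -
  have "ln ((1/16 :: real) ^ (2 ^ n)) \<le> ln (max (norm (fst (orbit n p))) ((1/16) ^ (2 ^ n)))"
    by (subst ln_le_cancel_iff) (auto simp: less_max_iff_disj)
  then show ?thesis by (simp only: ln_power_floor potential_approx_def) (simp add: le_divide_eq mult.commute)
qed

lemma potential_ge: "p \<in> basin \<Longrightarrow> ln (1/16) \<le> potential p"
  using potential_approx_ge by (intro LIMSEQ_le_const[OF potential_tendsto]) auto

text \<open>The origin is fixed and has the least possible value ln (1/16). At (1/4, 0) the first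
  approximation is ln (1/4), and the total error ln 2 leaves at least ln (1/8).\<close>

lemma potential_nonconstant: "\<exists>p\<in>basin. \<exists>q\<in>basin. potential p \<noteq> potential q"
proof -
  let ?q = "(1/4, 0) :: complex2"
  have 0: "0 \<in> basin_stage 0" and q: "?q \<in> basin_stage 0"
    by (simp_all add: basin_stage_def norm_Pair)
  have "potential_approx n 0 = ln (1/16)" for n
    by (simp add: potential_approx_def ln_power_floor max_absorb2 del: power_one_over)
  then have "potential 0 = ln (1/16)" by (simp add: potential_def)
  moreover have "potential_approx 0 ?q = ln (1/4)" by (simp add: potential_approx_def)
  then have "ln (1/4) - ln 2 \<le> potential ?q" using potential_approx_dist[OF q] by simp
  moreover have "ln (1/4) - ln 2 = ln (1/8 :: real)" using ln_mult[of 2 "1/8 :: real"] by simp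
  moreover have "ln (1/16) < ln (1/8 :: real)" by simp
  ultimately have "potential 0 \<noteq> potential ?q" by linarith
  then show ?thesis using 0 q by (auto simp: basin_def)
qed

lemma continuous_on_potential_approx: "continuous_on A (potential_approx n)"
  unfolding potential_approx_def[abs_def]
  by (intro continuous_intros continuous_on_orbit) (auto simp: max_def)

lemma continuous_on_potential: "continuous_on basin potential"
proof -
  have "continuous_on (basin_stage N) potential" for N
  proof (rule uniform_limit_theorem[where F = sequentially])
    show "uniform_limit (basin_stage N) potential_approx potential sequentially"
    proof (rule uniform_limitI)
      fix e :: real assume "0 < e"
      then have "\<forall>\<^sub>F n in sequentially. 1 * ln 2 / 2 ^ n < e"
        by (rule order_tendstoD(2)[OF ln_half_pow_tendsto_0])
      moreover have "\<forall>\<^sub>F n in sequentially. n \<ge> N" by (rule eventually_ge_at_top)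
      ultimately show "\<forall>\<^sub>F n in sequentially. \<forall>p\<in>basin_stage N. dist (potential_approx n p) (potential p) < e"
      proof eventually_elim
        case (elim n)
        show ?case
        proof
          fix p assume "p \<in> basin_stage N"
          then show "dist (potential_approx n p) (potential p) < e"
            using potential_approx_dist[OF basin_stage_mono] elim
            by (fastforce simp: dist_real_def abs_minus_commute)
        qed
      qed
    qed
  qed (auto intro: always_eventually continuous_on_potential_approx)
  then show ?thesis unfolding basin_def
    by (intro continuous_on_open_UN) (auto simp: open_basin_stage)
qed

lemma compact_subset_basinE:
  assumes "compact K" "K \<subseteq> basin"
  obtains N where "K \<subseteq> basin_stage N"
  using compact_subset_incseqE[of K basin_stage] assms incseq_basin_stage open_basin_stage
  unfolding basin_def by blast

text \<open>Orbits are holomorphic on all of C^2, so along a complex line their first coordinate is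
  entire and \<open>submean_ln_max\<close> applies to each approximation. The closed disc lies in
  one stage, so replacing the approximation by its limit costs 2 pi ln 2 / 2^n at the centre and as
  much again under the integral.\<close>

lemma potential_submean:
  assumes disc: "\<forall>\<zeta>\<in>cball 0 1. p + cscale \<zeta> v \<in> basin"
  shows "2 * pi * potential p \<le> integral {0..2*pi} (\<lambda>\<theta>. potential (p + cscale (exp (\<i> * of_real \<theta>)) v))"
proof -
  let ?c = "\<lambda>\<theta>::real. p + cscale (exp (\<i> * of_real \<theta>)) v"
  have "compact ((\<lambda>\<zeta>. p + cscale \<zeta> v) ` cball 0 1)"
    by (intro compact_continuous_image continuous_intros compact_cball)
  then obtain N where N: "(\<lambda>\<zeta>. p + cscale \<zeta> v) ` cball 0 1 \<subseteq> basin_stage N"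
    using compact_subset_basinE disc by (metis image_subsetI)
  have c: "?c \<theta> \<in> basin_stage N" for \<theta> using N by (auto simp: image_subset_iff)
  have p: "p \<in> basin_stage N"
    using N by (auto simp: image_subset_iff cscale_def zero_prod_def[symmetric] dest: bspec[of _ _ 0])
  have cb: "?c \<theta> \<in> basin" for \<theta> using c unfolding basin_def by blast
  have cc: "continuous_on A ?c" for A by (intro continuous_intros)
  have cu: "continuous_on {0..2*pi} (\<lambda>\<theta>. potential (?c \<theta>))"
    by (rule continuous_on_compose2[OF continuous_on_potential cc]) (use cb in blast)
  have approx: "2 * pi * potential p \<le> integral {0..2*pi} (\<lambda>\<theta>. potential (?c \<theta>)) + 4 * pi * ln 2 / 2 ^ n"
    if n: "n \<ge> N" for n
  proof -
    let ?f = "\<lambda>\<zeta>. fst (orbit n (p + cscale \<zeta> v))"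
    have "?f holomorphic_on UNIV"
      by (rule holomorphic2_on_curve(1)[OF holomorphic2_on_orbit open_UNIV])
        (auto intro!: holomorphic_intros)
    from submean_ln_max[OF this, of "(1/16) ^ (2 ^ n)"]
    have "2 * pi * (2 ^ n * potential_approx n p) \<le> integral {0..2*pi} (\<lambda>\<theta>. 2 ^ n * potential_approx n (?c \<theta>))"
      by (simp add: potential_approx_def cscale_def zero_prod_def[symmetric])
    then have "2 ^ n * (2 * pi * potential_approx n p) \<le> 2 ^ n * integral {0..2*pi} (\<lambda>\<theta>. potential_approx n (?c \<theta>))"
      by (simp add: algebra_simps)
    then have "2 * pi * potential_approx n p \<le> integral {0..2*pi} (\<lambda>\<theta>. potential_approx n (?c \<theta>))"
      by (simp only: mult_le_cancel_left_pos zero_less_power zero_less_numeral)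
    also have "\<dots> \<le> integral {0..2*pi} (\<lambda>\<theta>. potential (?c \<theta>) + ln 2 / 2 ^ n)"
    proof (rule integral_le)
      show "(\<lambda>\<theta>. potential_approx n (?c \<theta>)) integrable_on {0..2*pi}"
        by (intro integrable_continuous_real continuous_on_compose2[OF continuous_on_potential_approx cc]) auto
      show "(\<lambda>\<theta>. potential (?c \<theta>) + ln 2 / 2 ^ n) integrable_on {0..2*pi}"
        by (intro integrable_continuous_real continuous_intros cu) auto
      show "potential_approx n (?c \<theta>) \<le> potential (?c \<theta>) + ln 2 / 2 ^ n" for \<theta>
        using potential_approx_dist[OF basin_stage_mono[OF c n], of \<theta>] by linarith
    qed
    also have "\<dots> = integral {0..2*pi} (\<lambda>\<theta>. potential (?c \<theta>)) + 2 * pi * (ln 2 / 2 ^ n)"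
      using integrable_continuous_real[OF cu] by (subst Henstock_Kurzweil_Integration.integral_add) auto
    finally have "2 * pi * potential_approx n p \<le> integral {0..2*pi} (\<lambda>\<theta>. potential (?c \<theta>)) + 2 * pi * (ln 2 / 2 ^ n)" .
    moreover have "4 * pi * ln 2 / 2 ^ n = 2 * (2 * pi * (ln 2 / 2 ^ n))" by simp
    moreover have "2 * pi * potential p \<le> 2 * pi * (potential_approx n p + ln 2 / 2 ^ n)"
      using potential_approx_dist[OF basin_stage_mono[OF p n]] by (intro mult_left_mono) auto
    ultimately show ?thesis unfolding distrib_left by linarith
  qed
  have "(\<lambda>n. integral {0..2*pi} (\<lambda>\<theta>. potential (?c \<theta>)) + 4 * pi * ln 2 / 2 ^ n)
      \<longlonglongrightarrow> integral {0..2*pi} (\<lambda>\<theta>. potential (?c \<theta>)) + 0"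
    by (intro tendsto_add tendsto_const ln_half_pow_tendsto_0)
  then show ?thesis using approx by (intro LIMSEQ_le_const) auto
qed

lemma plurisubharmonic_potential: "plurisubharmonic_on (\<lambda>p. ereal (potential p)) basin"
  unfolding plurisubharmonic_on_def
proof (intro conjI ballI allI impI)
  fix p c assume p: "p \<in> basin" and c: "ereal (potential p) < c"
  have "(potential \<longlongrightarrow> potential p) (at p within basin)"
    using continuous_on_potential p by (simp add: continuous_on)
  then have "((\<lambda>p. ereal (potential p)) \<longlongrightarrow> ereal (potential p)) (at p within basin)"
    by (rule tendsto_ereal)
  then show "\<forall>\<^sub>F q in at p within basin. ereal (potential q) < c"
    using c by (rule order_tendstoD)
next
  fix p v assume disc: "\<forall>\<zeta>\<in>cball 0 1. p + cscale \<zeta> v \<in> basin"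
  let ?c = "\<lambda>\<theta>::real. p + cscale (exp (\<i> * of_real \<theta>)) v"
  have "continuous_on {0..2*pi} ?c" by (intro continuous_intros)
  then have "continuous_on {0..2*pi} (\<lambda>\<theta>. potential (?c \<theta>))"
    by (rule continuous_on_compose2[OF continuous_on_potential]) (use disc in auto)
  then have "circle_mean (\<lambda>\<theta>. ereal (potential (?c \<theta>))) = ereal (integral {0..2*pi} (\<lambda>\<theta>. potential (?c \<theta>)) / (2*pi))"
    by (rule circle_mean_continuous)
  then show "ereal (potential p) \<le> circle_mean (\<lambda>\<theta>. ereal (potential (?c \<theta>)))"
    using potential_submean[OF disc] by (simp add: le_divide_eq mult.commute)
qed simp

section \<open>The basin is a Short C^2, but it is not C^2\<close>

lemma short_C2_basin: "short_C2 basin"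
  unfolding short_C2_def
proof (intro conjI)
  show "\<exists>B. incseq B \<and> (\<forall>n. biholomorphic2 (ball 0 1) (B n)) \<and> basin = (\<Union>n. B n)"
    using ball_exhaustible_basin by (simp add: ball_exhaustible_def)
  show "\<exists>u. plurisubharmonic_on u basin \<and> \<not> (\<exists>c. \<forall>p\<in>basin. u p = c) \<and> (\<exists>M :: real. \<forall>p\<in>basin. u p \<le> ereal M)"
  proof (intro exI conjI)
    show "\<not> (\<exists>c. \<forall>p\<in>basin. ereal (potential p) = c)"
      using potential_nonconstant by (metis ereal.inject)
    show "\<forall>p\<in>basin. ereal (potential p) \<le> ereal 0" using potential_nonpos by simp
  qed (rule plurisubharmonic_potential)
qed (use domain2_basin kobayashi_metric_basin in auto)

text \<open>Liouville's theorem for the potential along an entire curve: the maximum principle on an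
  annulus is applied to \<open>f\<^sub>n \<cdot> (\<rho> / z) ^ (2 ^ (n - q))\<close>, with \<open>f\<^sub>n\<close> the first coordinate of the
  \<open>n\<close>-th orbit point; this is the usual comparison with \<open>2\<^sup>-\<^sup>q ln \<bar>z\<bar>\<close>.\<close>

lemma potential_entire_curve_le:
  fixes \<psi> :: "complex \<Rightarrow> complex2"
  assumes hol: "(\<lambda>z. fst (\<psi> z)) holomorphic_on UNIV" "(\<lambda>z. snd (\<psi> z)) holomorphic_on UNIV"
    and im: "\<And>z. \<psi> z \<in> basin"
  shows "potential (\<psi> 1) \<le> potential (\<psi> 0)"
proof -
  have contfs: "continuous_on UNIV (\<lambda>z. (fst (\<psi> z), snd (\<psi> z)))"
    using hol by (intro continuous_on_Pair holomorphic_on_imp_continuous_on)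
  then have cont\<psi>: "continuous_on A \<psi>" for A by (auto intro: continuous_on_subset)
  have contU: "continuous_on UNIV (\<lambda>z. potential (\<psi> z))"
    by (rule continuous_on_compose2[OF continuous_on_potential cont\<psi>]) (use im in auto)
  show ?thesis
  proof (rule field_le_epsilon)
    fix e :: real assume "0 < e"
    \<comment> \<open>The error \<open>e\<close> is split in three: continuity at 0, the term
      \<open>ln (1 / \<rho>) / 2 ^ q\<close>, and twice the approximation error \<open>c\<close>,
      which occurs on the inner circle and at the point 1.\<close>
    define m where "m = potential (\<psi> 0) + e / 3"
    have "isCont (\<lambda>z. potential (\<psi> z)) 0" using contU by (simp add: continuous_on_eq_continuous_at)
    then obtain d where d: "d > 0" "\<And>z. norm z < d \<Longrightarrow> \<bar>potential (\<psi> z) - potential (\<psi> 0)\<bar> < e / 3"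
      using \<open>0 < e\<close> unfolding continuous_at_eps_delta dist_real_def
      by (metis dist_0_norm dist_commute divide_pos_pos zero_less_numeral)
    define \<rho> where "\<rho> = min (d / 2) (1/2)"
    have \<rho>: "0 < \<rho>" "\<rho> < 1" "\<rho> < d" using d(1) by (auto simp: \<rho>_def)
    have le_m: "potential (\<psi> z) \<le> m" if "norm z = \<rho>" for z
    proof -
      have "\<bar>potential (\<psi> z) - potential (\<psi> 0)\<bar> < e / 3" by (rule d(2)) (use \<rho> that in simp)
      then show ?thesis unfolding m_def by linarith
    qed
    obtain q :: nat where q: "ln (1 / \<rho>) / 2 ^ q < e / 3"
    proof -
      have "(\<lambda>q. ln (1 / \<rho>) * (1/2 :: real) ^ q) \<longlonglongrightarrow> ln (1 / \<rho>) * 0"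
        by (intro tendsto_mult_left LIMSEQ_power_zero) auto
      then have "\<forall>\<^sub>F q in sequentially. ln (1 / \<rho>) * (1/2 :: real) ^ q < e / 3"
        using \<open>0 < e\<close> by (intro order_tendstoD(2)) auto
      then show ?thesis using that by (auto simp: eventually_sequentially power_divide)
    qed
    \<comment> \<open>On the outer circle only |f| <= 1 is available, so \<open>R\<close> is taken
      large enough for the factor (\<rho> / R)^j alone to lie below \<open>?B\<close>. It depends on
      \<open>q\<close> but not on \<open>n\<close>, which is chosen later; the 2 keeps the point 1
      inside the annulus.\<close>
    define R where "R = max 2 (\<rho> * exp (- m * 2 ^ q))"
    have R: "1 < R" "\<rho> < R" using \<rho> by (auto simp: R_def)
    have Rm: "- m * 2 ^ q \<le> ln (R / \<rho>)"
    proof -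
      have "exp (- m * 2 ^ q) \<le> R / \<rho>" using \<rho> by (simp add: R_def pos_le_divide_eq mult.commute)
      then show ?thesis using R \<rho> by (simp add: ln_ge_iff)
    qed
    obtain N where N: "\<psi> ` cball 0 R \<subseteq> basin_stage N"
      using compact_subset_basinE[of "\<psi> ` cball 0 R"] im cont\<psi> compact_continuous_image
      by (metis compact_cball image_subsetI)
    have "\<forall>\<^sub>F n in sequentially. 2 * ln 2 / 2 ^ n < e / 3"
      by (rule order_tendstoD(2)[OF ln_half_pow_tendsto_0]) (use \<open>0 < e\<close> in simp)
    then obtain n1 where n1: "\<And>n. n \<ge> n1 \<Longrightarrow> 2 * ln 2 / 2 ^ n < e / 3"
      by (auto simp: eventually_sequentially)
    define n where "n = max (max N q) n1"
    have n: "n \<ge> N" "n \<ge> q" "2 * ln 2 / 2 ^ n < e / 3" using n1 by (auto simp: n_def)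
    define c :: real where "c = ln 2 / 2 ^ n"
    have c: "0 \<le> c" "2 * c < e / 3" using n(3) by (simp_all add: c_def)
    have stage: "\<psi> z \<in> basin_stage n" if "norm z \<le> R" for z
      using N that basin_stage_mono[OF _ n(1)] by (auto simp: image_subset_iff)
    define f where "f = (\<lambda>z. fst (orbit n (\<psi> z)))"
    have holf: "f holomorphic_on A" for A
      unfolding f_def using holomorphic2_on_curve(1)[OF holomorphic2_on_orbit open_UNIV hol subset_UNIV]
      by (rule holomorphic_on_subset) simp
    \<comment> \<open>Since \<open>j * 2 ^ q = 2 ^ n\<close>, after division by \<open>2 ^ n\<close>
      the auxiliary factor costs ln (1 / \<rho>) / 2^q at the point 1, independently of
      \<open>n\<close>.\<close>
    define j :: nat where "j = 2 ^ (n - q)"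
    have j: "real j * 2 ^ q = 2 ^ n" using n(2) by (simp add: j_def flip: power_add)
    let ?S = "cball 0 R - ball (0::complex) \<rho>"
    let ?B = "exp (2 ^ n * (m + c))"
    let ?g = "\<lambda>z. f z * (of_real \<rho> * inverse z) ^ j"
    have S: "closed ?S" by (intro closed_Diff) auto
    have int: "ball 0 R - cball 0 \<rho> \<subseteq> interior ?S"
      by (intro interior_maximal open_Diff) auto
    have "norm (?g 1) \<le> ?B"
    proof (rule maximum_modulus_frontier[where S = ?S and f = ?g])
      have S0: "?S \<subseteq> - {0}" using \<rho> by auto
      have hol0: "?g holomorphic_on - {0}" by (auto intro!: holomorphic_intros holf)
      show "?g holomorphic_on interior ?S"
        by (rule holomorphic_on_subset[OF hol0]) (rule order_trans[OF interior_subset S0])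
      show "continuous_on (closure ?S) ?g" unfolding closure_closed[OF S]
        by (rule holomorphic_on_imp_continuous_on[OF holomorphic_on_subset[OF hol0 S0]])
      show "bounded ?S" by (intro bounded_diff) auto
      show "1 \<in> ?S" using \<rho> R by simp
    next
      fix z assume z: "z \<in> frontier ?S"
      then have "z \<in> ?S" "z \<notin> ball 0 R - cball 0 \<rho>"
        using S int unfolding frontier_def by auto
      then consider "norm z = \<rho>" | "norm z = R" by force
      then show "norm (?g z) \<le> ?B"
      proof cases
        case 1
        have "potential_approx n (\<psi> z) \<le> m + c"
          using potential_approx_dist[OF stage[of z]] le_m[OF 1] 1 R by (simp add: c_def)
        then have "ln (max (norm (f z)) ((1/16) ^ (2 ^ n))) \<le> 2 ^ n * (m + c)"
          by (simp add: potential_approx_def f_def divide_le_eq mult.commute)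
        then have "max (norm (f z)) ((1/16) ^ (2 ^ n)) \<le> ?B"
          by (subst (asm) ln_le_iff_le_exp) (auto simp: less_max_iff_disj)
        then show ?thesis using 1 \<rho> by (simp add: norm_mult norm_power norm_inverse)
      next
        case 2
        have "norm (f z) \<le> 1" using stage[of z] 2 norm_fst_snd_le(1)[of "orbit n (\<psi> z)"]
          by (simp add: f_def basin_stage_def)
        then have "norm (?g z) \<le> (\<rho> / R) ^ j"
          using 2 \<rho> R by (simp add: norm_mult norm_power norm_inverse divide_inverse mult_left_le_one_le)
        also have "(\<rho> / R) ^ j = exp (- (real j * ln (R / \<rho>)))"
          using \<rho> R by (simp add: exp_minus exp_of_nat_mult power_divide)
        also have "\<dots> \<le> ?B"
        proof -
          have "real j * (- m * 2 ^ q) \<le> real j * ln (R / \<rho>)"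
            using Rm by (intro mult_left_mono) auto
          moreover have "real j * (- m * 2 ^ q) = - (2 ^ n * m)" using j by (simp add: algebra_simps)
          moreover have "0 \<le> 2 ^ n * c" using c by simp
          ultimately show ?thesis unfolding exp_le_cancel_iff distrib_left by linarith
        qed
        finally show ?thesis .
      qed
    qed
    then have "norm (f 1) * \<rho> ^ j \<le> ?B" using \<rho> by (simp add: norm_mult norm_power)
    then have "norm (f 1) \<le> ?B * (1 / \<rho>) ^ j" using \<rho> by (simp add: power_divide pos_le_divide_eq)
    also have "(1 / \<rho>) ^ j = exp (real j * ln (1 / \<rho>))" using \<rho> by (simp add: exp_of_nat_mult)
    also have "?B * exp (real j * ln (1 / \<rho>)) = exp (2 ^ n * (m + c) + real j * ln (1 / \<rho>))"
      by (simp add: exp_add)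
    also have "2 ^ n * (m + c) + real j * ln (1 / \<rho>) = 2 ^ n * (m + c + ln (1 / \<rho>) / 2 ^ q)"
      unfolding j[symmetric] by (simp add: algebra_simps)
    finally have f1: "norm (f 1) \<le> exp (2 ^ n * (m + c + ln (1 / \<rho>) / 2 ^ q))" .
    \<comment> \<open>The logarithm in \<open>potential_approx\<close> is taken after the cut-off,
      so the cut-off has to satisfy the bound too; it does because the potential is at least ln
      (1/16).\<close>
    have "(1/16 :: real) ^ (2 ^ n) \<le> exp (2 ^ n * (m + c + ln (1 / \<rho>) / 2 ^ q))"
    proof -
      have "ln (1/16) \<le> m + c + ln (1 / \<rho>) / 2 ^ q"
        using potential_ge[OF im[of 0]] \<open>0 < e\<close> c \<rho> by (simp add: m_def add_increasing2)
      then have "2 ^ n * ln (1/16) \<le> 2 ^ n * (m + c + ln (1 / \<rho>) / 2 ^ q)"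
        by (intro mult_left_mono) auto
      then have "exp (2 ^ n * ln (1/16)) \<le> exp (2 ^ n * (m + c + ln (1 / \<rho>) / 2 ^ q))" by simp
      then show ?thesis by (simp only: ln_power_floor[symmetric]) simp
    qed
    with f1 have "max (norm (f 1)) ((1/16) ^ (2 ^ n)) \<le> exp (2 ^ n * (m + c + ln (1 / \<rho>) / 2 ^ q))"
      by simp
    then have "ln (max (norm (f 1)) ((1/16) ^ (2 ^ n))) \<le> 2 ^ n * (m + c + ln (1 / \<rho>) / 2 ^ q)"
      by (subst ln_le_iff_le_exp) (auto simp: less_max_iff_disj)
    then have "potential_approx n (\<psi> 1) \<le> m + c + ln (1 / \<rho>) / 2 ^ q"
      by (simp add: potential_approx_def f_def divide_le_eq mult.commute)
    moreover have "\<bar>potential (\<psi> 1) - potential_approx n (\<psi> 1)\<bar> \<le> c"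
      using potential_approx_dist[OF stage[of 1]] R by (simp add: c_def)
    ultimately show "potential (\<psi> 1) \<le> potential (\<psi> 0) + e"
      using c q unfolding m_def by linarith
  qed
qed

text \<open>Any two points of C^2 lie on a complex line, whose image is an entire curve in the
  basin. Comparing the potential in both orders would make it constant.\<close>

lemma basin_not_biholomorphic2_UNIV: "\<not> biholomorphic2 basin UNIV"
proof
  assume "biholomorphic2 basin UNIV"
  then obtain f g where fg: "holomorphic2_on f basin" "holomorphic2_on g UNIV"
    "\<forall>p\<in>basin. f p \<in> UNIV" "\<forall>p\<in>UNIV. g p \<in> basin" "\<forall>p\<in>basin. g (f p) = p" "\<forall>p\<in>UNIV. f (g p) = p"
    by (rule biholomorphic2E)
  have "potential p \<le> potential q" if pq: "p \<in> basin" "q \<in> basin" for p q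
  proof -
    let ?l = "\<lambda>z. f q + cscale z (f p - f q)"
    have l: "(\<lambda>z. fst (?l z)) holomorphic_on UNIV" "(\<lambda>z. snd (?l z)) holomorphic_on UNIV"
      by (auto intro!: holomorphic_intros)
    note cu = holomorphic2_on_curve[OF fg(2) open_UNIV l subset_UNIV]
    have "potential (g (?l 1)) \<le> potential (g (?l 0))"
      by (rule potential_entire_curve_le[OF cu(1,2)]) (use fg(4) in blast)
    moreover have "?l 1 = f p" "?l 0 = f q" by (simp_all add: cscale_def prod_eq_iff)
    ultimately show ?thesis using fg(5) pq by simp
  qed
  then show False using potential_nonconstant by (meson antisym)
qed

theorem theorem4p5:
  shows "\<exists>\<Omega>. short_C2 \<Omega> \<and> \<not> (\<exists>G. domain2 G \<and> reinhardt G \<and> biholomorphic2 \<Omega> G)"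
proof (intro exI conjI notI)
  show "short_C2 basin" by (rule short_C2_basin)
  assume "\<exists>G. domain2 G \<and> reinhardt G \<and> biholomorphic2 basin G"
  then obtain G where G: "domain2 G" "reinhardt G" "biholomorphic2 basin G" by blast
  have "G = UNIV"
  proof (rule reinhardt_ball_exhaustible_kobayashi_zero)
    show "ball_exhaustible G"
      using ball_exhaustible_basin G(3) by (rule ball_exhaustible_biholomorphic2)
    show "kobayashi_metric G p v = 0" if "p \<in> G" for p v
      by (rule kobayashi_metric_eq_0_biholomorphic2[OF G(3) open_basin kobayashi_metric_basin that])
  qed (use G in auto)
  then show False using G(3) basin_not_biholomorphic2_UNIV by blast
qed

end
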